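(* A semigroup $S$ is a left I-order in a Brandt semigroup $Q$ if and only if $S$ has a zero element $0$ and satisfies all of the following conditions: (A) $S$ is categorical at $0$; (B) $S$ is $0$-cancellative; (C) the relation $\lambda$ on $S$ is transitive; (D) $Sa\neq \{0\}$ for all $a\in S$ with $a\neq 0$; and in addition, for all nonzero $a,b\in S$ there exist $c,d\in S$ such that $ca\,\mathcal{R}^{*}\,d$ and $d\,\lambda\,b$.
   Context: A semigroup $S$ with zero $0$ is categorical at $0$ if, for all $a,b,c\in S$, $ab\neq 0$ and $bc\neq 0$ imply $abc\neq 0$. It is $0$-cancellative if, for all $a,b,c\in S$, $ab=ac\neq 0$ implies $b=c$, and $ba=ca\neq 0$ implies $b=c$. The relation $\lambda$ on $S$ is defined by: $a\,\lambda\,b$ if and only if $a=b=0$ or $Sa\cap Sb\neq\{0\}$. The relation $\mathcal{R}^{*}$ on $S$ is defined by: $a\,\mathcal{R}^{*}\,b$ if and only if for all $x,y\in S^{1}$, $xa=ya\Leftrightarrow xb=yb$, where $S^{1}$ is $S$ with an identity adjoined if necessary. A Brandt semigroup is a completely $0$-simple inverse semigroup; equivalently, a semigroup isomorphic to $B(G,I)=(I\times G\times I)\cup\{0\}$ for some group $G$ and nonempty set $I$, with $(i,a,j)(k,b,l)=(i,ab,l)$ if $j=k$ and $0$ otherwise, and all products involving $0$ equal to $0$. A subsemigroup $S$ of an inverse semigroup $Q$ is a left I-order in $Q$ if every $q\in Q$ can be written as $q=a^{-1}b$ with $a,b\in S$, where $a^{-1}$ is the inverse of $a$ in $Q$. An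 abstract semigroup $S$ is said to be a left I-order in $Q$ if it embeds in $Q$ as such a subsemigroup.
   Formalization: "Has a zero element" is taken to require that S has at least two elements; S = {0} satisfies (A)–(D) and the last condition vacuously, but is not a left I-order in any Brandt semigroup. *)

theory Defs
  imports "HOL-Algebra.Coset"
begin

text \<open>
  Semigroups are represented by the \<^type>\<open>monoid_ext\<close> records of HOL-Algebra, of which only
  the fields \<^const>\<open>carrier\<close> and \<^const>\<open>mult\<close> are used; the field \<^const>\<open>one\<close> is irrelevant
  everywhere except in \<open>adjoin_one\<close>, where it is the identity of $S^1$.
\<close>

definition is_semigroup :: "('a, 'b) monoid_scheme \<Rightarrow> bool" where
  "is_semigroup S \<longleftrightarrow>
     (\<forall>x\<in>carrier S. \<forall>y\<in>carrier S. x \<otimes>\<^bsub>S\<^esub> y \<in> carrier S) \<and>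
     (\<forall>x\<in>carrier S. \<forall>y\<in>carrier S. \<forall>z\<in>carrier S.
        (x \<otimes>\<^bsub>S\<^esub> y) \<otimes>\<^bsub>S\<^esub> z = x \<otimes>\<^bsub>S\<^esub> (y \<otimes>\<^bsub>S\<^esub> z))"

text \<open>
  As usual in semigroup theory (e.g. Howie, \<^emph>\<open>Fundamentals of Semigroup Theory\<close>), only a
  semigroup with at least two elements is said to have a zero. This matters for the trivial
  semigroup: it cannot be a left I-order in a Brandt semigroup, yet its only element would
  satisfy every condition on nonzero elements vacuously.
\<close>

definition is_zero :: "('a, 'b) monoid_scheme \<Rightarrow> 'a \<Rightarrow> bool" where
  "is_zero S z \<longleftrightarrow>
     z \<in> carrier S \<and> carrier S \<noteq> {z} \<and>
     (\<forall>x\<in>carrier S. z \<otimes>\<^bsub>S\<^esub> x = z \<and> x \<otimes>\<^bsub>S\<^esub> z = z)"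

text \<open>In the following definitions the argument \<open>z\<close> stands for the zero of the semigroup.\<close>

definition categorical_at_zero :: "('a, 'b) monoid_scheme \<Rightarrow> 'a \<Rightarrow> bool" where
  "categorical_at_zero S z \<longleftrightarrow>
     (\<forall>a\<in>carrier S. \<forall>b\<in>carrier S. \<forall>c\<in>carrier S.
        a \<otimes>\<^bsub>S\<^esub> b \<noteq> z \<and> b \<otimes>\<^bsub>S\<^esub> c \<noteq> z \<longrightarrow> a \<otimes>\<^bsub>S\<^esub> b \<otimes>\<^bsub>S\<^esub> c \<noteq> z)"

definition zero_cancellative :: "('a, 'b) monoid_scheme \<Rightarrow> 'a \<Rightarrow> bool" where
  "zero_cancellative S z \<longleftrightarrow>
     (\<forall>a\<in>carrier S. \<forall>b\<in>carrier S. \<forall>c\<in>carrier S.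
        (a \<otimes>\<^bsub>S\<^esub> b = a \<otimes>\<^bsub>S\<^esub> c \<and> a \<otimes>\<^bsub>S\<^esub> c \<noteq> z \<longrightarrow> b = c) \<and>
        (b \<otimes>\<^bsub>S\<^esub> a = c \<otimes>\<^bsub>S\<^esub> a \<and> c \<otimes>\<^bsub>S\<^esub> a \<noteq> z \<longrightarrow> b = c))"

text \<open>\<open>carrier S #>\<^bsub>S\<^esub> a\<close> is the set $Sa$.\<close>

definition lambda_rel :: "('a, 'b) monoid_scheme \<Rightarrow> 'a \<Rightarrow> 'a rel" where
  "lambda_rel S z =
     {(a, b). a \<in> carrier S \<and> b \<in> carrier S \<and>
        (a = z \<and> b = z \<or> (carrier S #>\<^bsub>S\<^esub> a) \<inter> (carrier S #>\<^bsub>S\<^esub> b) \<noteq> {z})}"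

definition is_identity :: "('a, 'b) monoid_scheme \<Rightarrow> 'a \<Rightarrow> bool" where
  "is_identity S e \<longleftrightarrow>
     e \<in> carrier S \<and> (\<forall>x\<in>carrier S. e \<otimes>\<^bsub>S\<^esub> x = x \<and> x \<otimes>\<^bsub>S\<^esub> e = x)"

text \<open>
  $S^1$: the elements of \<open>S\<close> appear as \<open>Some x\<close>, and \<open>None\<close> is the new identity, which belongs to
  the carrier only if \<open>S\<close> has no identity of its own.
\<close>

definition adjoin_one :: "('a, 'b) monoid_scheme \<Rightarrow> 'a option monoid" where
  "adjoin_one S =
     \<lparr>carrier = Some ` carrier S \<union> (if \<exists>e. is_identity S e then {} else {None}),
      mult = (\<lambda>x y. case x of None \<Rightarrow> y
                    | Some a \<Rightarrow> (case y of None \<Rightarrow> x | Some b \<Rightarrow> Some (a \<otimes>\<^bsub>S\<^esub> b))),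
      one = (if \<exists>e. is_identity S e then Some (THE e. is_identity S e) else None)\<rparr>"

definition R_star :: "('a, 'b) monoid_scheme \<Rightarrow> 'a rel" where
  "R_star S =
     {(a, b). a \<in> carrier S \<and> b \<in> carrier S \<and>
        (\<forall>x\<in>carrier (adjoin_one S). \<forall>y\<in>carrier (adjoin_one S).
           x \<otimes>\<^bsub>adjoin_one S\<^esub> Some a = y \<otimes>\<^bsub>adjoin_one S\<^esub> Some a \<longleftrightarrow>
           x \<otimes>\<^bsub>adjoin_one S\<^esub> Some b = y \<otimes>\<^bsub>adjoin_one S\<^esub> Some b)}"

definition is_inverse :: "('a, 'b) monoid_scheme \<Rightarrow> 'a \<Rightarrow> 'a \<Rightarrow> bool" where
  "is_inverse Q a b \<longleftrightarrow>
     b \<in> carrier Q \<and> a \<otimes>\<^bsub>Q\<^esub> b \<otimes>\<^bsub>Q\<^esub> a = a \<and> b \<otimes>\<^bsub>Q\<^esub> a \<otimes>\<^bsub>Q\<^esub> b = b"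

definition inverse_semigroup :: "('a, 'b) monoid_scheme \<Rightarrow> bool" where
  "inverse_semigroup Q \<longleftrightarrow> is_semigroup Q \<and> (\<forall>a\<in>carrier Q. \<exists>!b. is_inverse Q a b)"

text \<open>Not \<^const>\<open>m_inv\<close>, which is the group-theoretic inverse with respect to \<^const>\<open>one\<close>.\<close>

definition sinv :: "('a, 'b) monoid_scheme \<Rightarrow> 'a \<Rightarrow> 'a" where
  "sinv Q a = (THE b. is_inverse Q a b)"

definition semigroup_ideal :: "('a, 'b) monoid_scheme \<Rightarrow> 'a set \<Rightarrow> bool" where
  "semigroup_ideal Q I \<longleftrightarrow>
     I \<noteq> {} \<and> I \<subseteq> carrier Q \<and> carrier Q <#>\<^bsub>Q\<^esub> I \<subseteq> I \<and> I <#>\<^bsub>Q\<^esub> carrier Q \<subseteq> I"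

definition zero_simple :: "('a, 'b) monoid_scheme \<Rightarrow> 'a \<Rightarrow> bool" where
  "zero_simple Q z \<longleftrightarrow>
     is_semigroup Q \<and> is_zero Q z \<and> carrier Q <#>\<^bsub>Q\<^esub> carrier Q \<noteq> {z} \<and>
     (\<forall>I. semigroup_ideal Q I \<longrightarrow> I = {z} \<or> I = carrier Q)"

definition idempotent :: "('a, 'b) monoid_scheme \<Rightarrow> 'a \<Rightarrow> bool" where
  "idempotent Q e \<longleftrightarrow> e \<in> carrier Q \<and> e \<otimes>\<^bsub>Q\<^esub> e = e"

text \<open>Minimal among the nonzero idempotents in the order $f \le e \iff ef = fe = f$.\<close>

definition primitive_idempotent :: "('a, 'b) monoid_scheme \<Rightarrow> 'a \<Rightarrow> 'a \<Rightarrow> bool" where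
  "primitive_idempotent Q z e \<longleftrightarrow>
     idempotent Q e \<and> e \<noteq> z \<and>
     (\<forall>f. idempotent Q f \<and> f \<noteq> z \<and> e \<otimes>\<^bsub>Q\<^esub> f = f \<and> f \<otimes>\<^bsub>Q\<^esub> e = f \<longrightarrow> f = e)"

definition completely_zero_simple :: "('a, 'b) monoid_scheme \<Rightarrow> bool" where
  "completely_zero_simple Q \<longleftrightarrow>
     (\<exists>z. zero_simple Q z \<and> (\<exists>e. primitive_idempotent Q z e))"

definition brandt_semigroup :: "('a, 'b) monoid_scheme \<Rightarrow> bool" where
  "brandt_semigroup Q \<longleftrightarrow> completely_zero_simple Q \<and> inverse_semigroup Q"

definition subsemigroup :: "'a set \<Rightarrow> ('a, 'b) monoid_scheme \<Rightarrow> bool" where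
  "subsemigroup T Q \<longleftrightarrow> T \<subseteq> carrier Q \<and> (\<forall>x\<in>T. \<forall>y\<in>T. x \<otimes>\<^bsub>Q\<^esub> y \<in> T)"

definition left_I_order_within :: "'a set \<Rightarrow> ('a, 'b) monoid_scheme \<Rightarrow> bool" where
  "left_I_order_within T Q \<longleftrightarrow>
     inverse_semigroup Q \<and> subsemigroup T Q \<and>
     (\<forall>q\<in>carrier Q. \<exists>a\<in>T. \<exists>b\<in>T. q = sinv Q a \<otimes>\<^bsub>Q\<^esub> b)"

definition left_I_order :: "('a, 'b) monoid_scheme \<Rightarrow> ('c, 'd) monoid_scheme \<Rightarrow> bool" where
  "left_I_order S Q \<longleftrightarrow> (\<exists>\<phi>\<in>mon S Q. left_I_order_within (\<phi> ` carrier S) Q)"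

end

theory Submission
  imports Defs
begin

text \<open>
  A Brandt semigroup is a connected groupoid with a zero adjoined, so a left I-order in it is a
  small category, without identities but with cancellation and the left Ore condition, embedded
  in its groupoid of left fractions. In this picture \<open>\<lambda>\<close> says that two elements have the same
  target and \<open>\<R>\<^sup>*\<close> that they have the same source. Transitivity of \<open>\<lambda>\<close> amounts to the Ore condition,
  and the last condition to connectedness: the elements \<open>c\<close> and \<open>d\<close> provide a morphism
  \<open>c\<^sup>-\<^sup>1 d\<close> from the source of \<open>a\<close> to the target of \<open>b\<close>.

  Conversely, let \<open>\<rho>\<^sub>a\<close> be the partial injection \<open>u \<mapsto> u a\<close>, defined where \<open>u a \<noteq> 0\<close>. The fraction
  \<open>a\<^sup>-\<^sup>1 b\<close> is realised as the relation obtained from \<open>\<rho>\<^sub>a\<^sup>-\<^sup>1 \<rho>\<^sub>b\<close> by cancelling common left factors,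
  which is also the set of pairs representing that fraction. Hence the product of fractions is
  relational composition up to such cancellation, the inverse is the converse relation, and
  nothing has to be checked on representatives.
\<close>

lemma r_coset_iff: "y \<in> carrier S #>\<^bsub>S\<^esub> a \<longleftrightarrow> (\<exists>x\<in>carrier S. y = x \<otimes>\<^bsub>S\<^esub> a)"
  unfolding r_coset_def by auto

section \<open>Brandt semigroups\<close>

locale zero_semigroup =
  fixes Q :: "('a, 'b) monoid_scheme" (structure) and z :: 'a
  assumes closed [simp, intro]: "x \<in> carrier Q \<Longrightarrow> y \<in> carrier Q \<Longrightarrow> x \<otimes> y \<in> carrier Q"
    and assoc: "x \<in> carrier Q \<Longrightarrow> y \<in> carrier Q \<Longrightarrow> w \<in> carrier Q \<Longrightarrow>
      (x \<otimes> y) \<otimes> w = x \<otimes> (y \<otimes> w)"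
    and zero_in [simp, intro]: "z \<in> carrier Q"
    and zero_mult [simp]: "x \<in> carrier Q \<Longrightarrow> z \<otimes> x = z"
    and mult_zero [simp]: "x \<in> carrier Q \<Longrightarrow> x \<otimes> z = z"
    and nontrivial: "carrier Q \<noteq> {z}"

lemma zero_semigroup_iff: "zero_semigroup Q z \<longleftrightarrow> is_semigroup Q \<and> is_zero Q z"
  unfolding zero_semigroup_def is_semigroup_def is_zero_def by (rule iffI) simp_all

text \<open>
  A first-order description of Brandt semigroups: they are the zero semigroups whose nonzero
  elements form a connected groupoid, with \<open>i\<close> as the groupoid inverse.
\<close>

locale brandt = zero_semigroup +
  fixes i :: "'a \<Rightarrow> 'a"
  assumes inv_in [simp, intro]: "x \<in> carrier Q \<Longrightarrow> i x \<in> carrier Q"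
    and inv_outer: "x \<in> carrier Q \<Longrightarrow> x \<otimes> (i x \<otimes> x) = x"
    and inv_inner: "x \<in> carrier Q \<Longrightarrow> i x \<otimes> (x \<otimes> i x) = i x"
    and inv_cancel: "x \<in> carrier Q \<Longrightarrow> y \<in> carrier Q \<Longrightarrow> x \<otimes> y \<noteq> z \<Longrightarrow> i x \<otimes> (x \<otimes> y) = y"
    and cancel_inv: "x \<in> carrier Q \<Longrightarrow> y \<in> carrier Q \<Longrightarrow> x \<otimes> y \<noteq> z \<Longrightarrow> x \<otimes> (y \<otimes> i y) = x"
    and connected: "x \<in> carrier Q \<Longrightarrow> y \<in> carrier Q \<Longrightarrow> x \<noteq> z \<Longrightarrow> y \<noteq> z \<Longrightarrow>
      \<exists>c\<in>carrier Q. x \<otimes> (c \<otimes> y) \<noteq> z"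
begin

section \<open>The groupoid laws yield a Brandt semigroup\<close>

lemma left_cancel:
  assumes "x \<in> carrier Q" "y \<in> carrier Q" "w \<in> carrier Q" "x \<otimes> y = x \<otimes> w" "x \<otimes> w \<noteq> z"
  shows "y = w"
  using assms inv_cancel by metis

lemma right_cancel:
  assumes "x \<in> carrier Q" "y \<in> carrier Q" "w \<in> carrier Q" "y \<otimes> x = w \<otimes> x" "w \<otimes> x \<noteq> z"
  shows "y = w"
  using assms cancel_inv assoc inv_in by metis

text \<open>Left multiplication by \<open>i x\<close> turns \<open>x (y w)\<close> back into
  \<open>y w\<close>, so the triple product cannot vanish.\<close>

lemma categorical:
  assumes "x \<in> carrier Q" "y \<in> carrier Q" "w \<in> carrier Q" "x \<otimes> y \<noteq> z" "y \<otimes> w \<noteq> z"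
  shows "x \<otimes> (y \<otimes> w) \<noteq> z"
proof
  assume "x \<otimes> (y \<otimes> w) = z"
  moreover have "i x \<otimes> (x \<otimes> (y \<otimes> w)) = (i x \<otimes> (x \<otimes> y)) \<otimes> w"
    using assms by (simp add: assoc)
  ultimately show False using assms inv_cancel[of x y] by simp
qed

lemma is_inverse_inv: "x \<in> carrier Q \<Longrightarrow> is_inverse Q x (i x)"
  unfolding is_inverse_def by (simp add: assoc inv_outer inv_inner)

text \<open>For nonzero \<open>x\<close>, compare \<open>x y x = x\<close> with
  \<open>x (i x) x = x\<close> and cancel \<open>x\<close> on the left, then on the right.
  Cancellation says nothing at the zero, where \<open>y = y z y = z\<close>.\<close>

lemma inverse_unique:
  assumes "x \<in> carrier Q" "is_inverse Q x y"
  shows "y = i x"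
proof (cases "x = z")
  case True
  have "i z = i z \<otimes> (z \<otimes> i z)" using inv_inner[of z] by simp
  then show ?thesis using assms True unfolding is_inverse_def by auto
next
  case False
  have y: "y \<in> carrier Q" "x \<otimes> (y \<otimes> x) = x"
    using assms assoc unfolding is_inverse_def by auto
  have "y \<otimes> x = i x \<otimes> x"
    by (rule left_cancel[of x]) (use assms y False inv_outer in simp_all)
  moreover have "i x \<otimes> x \<noteq> z"
    using inv_outer[OF assms(1)] assms(1) False mult_zero by metis
  ultimately show ?thesis
    by (intro right_cancel[of x y "i x"] assms(1) y(1) inv_in)
qed

lemma sinv_eq: "x \<in> carrier Q \<Longrightarrow> sinv Q x = i x"
  unfolding sinv_def by (rule the_equality) (auto intro: is_inverse_inv inverse_unique)

lemma inv_inv: "x \<in> carrier Q \<Longrightarrow> i (i x) = x"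
  by (rule inverse_unique[symmetric]) (auto simp: is_inverse_def assoc inv_outer inv_inner)

lemma inv_zero [simp]: "i z = z"
  using inv_inner[of z] by simp

lemma inv_eq_zero: "x \<in> carrier Q \<Longrightarrow> i x = z \<longleftrightarrow> x = z"
  using inv_inv inv_zero by metis

lemma mult_inv_nonzero: "x \<in> carrier Q \<Longrightarrow> x \<noteq> z \<Longrightarrow> x \<otimes> i x \<noteq> z"
  using inv_outer[of x] assoc[of x "i x" x] zero_mult inv_in by metis

text \<open>Because the product is nonzero, \<open>y (i y)\<close> is a right identity for
  \<open>x\<close> and \<open>(i x) x\<close> a left identity for \<open>y\<close>; the middle
  factors therefore collapse in both defining equations of an inverse.\<close>

lemma inv_mult:
  assumes "x \<in> carrier Q" "y \<in> carrier Q" "x \<otimes> y \<noteq> z"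
  shows "i (x \<otimes> y) = i y \<otimes> i x"
proof -
  have 1: "x \<otimes> (y \<otimes> i y) = x" "i x \<otimes> (x \<otimes> y) = y"
    using assms cancel_inv inv_cancel by auto
  have 2: "(x \<otimes> y) \<otimes> (i y \<otimes> i x) \<otimes> (x \<otimes> y) = (x \<otimes> (y \<otimes> i y)) \<otimes> (i x \<otimes> (x \<otimes> y))"
    using assms by (simp add: assoc)
  have "(i y \<otimes> i x) \<otimes> (x \<otimes> y) \<otimes> (i y \<otimes> i x) = i y \<otimes> ((i x \<otimes> (x \<otimes> y)) \<otimes> (i y \<otimes> i x))"
    using assms by (simp add: assoc)
  also have "\<dots> = i y \<otimes> (y \<otimes> i y) \<otimes> i x"
    unfolding 1 using assms by (simp add: assoc)
  also have "\<dots> = i y \<otimes> i x" using assms by (simp add: inv_inner)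
  finally have "is_inverse Q (x \<otimes> y) (i y \<otimes> i x)"
    using assms 2 unfolding 1 is_inverse_def by simp
  then show ?thesis using assms inverse_unique by simp
qed

text \<open>A nonzero \<open>y\<close> in the ideal pulls in every nonzero \<open>x\<close>:
  connectedness gives \<open>c\<close> with \<open>x c y\<close> nonzero, and then
  \<open>x = x (c y) (i (c y))\<close> has the factor \<open>y\<close>.\<close>

lemma ideal_trivial:
  assumes I: "semigroup_ideal Q I"
  shows "I = {z} \<or> I = carrier Q"
proof -
  have sub: "I \<noteq> {}" "I \<subseteq> carrier Q"
    and l: "\<And>x y. x \<in> carrier Q \<Longrightarrow> y \<in> I \<Longrightarrow> x \<otimes> y \<in> I"
    and r: "\<And>x y. x \<in> carrier Q \<Longrightarrow> y \<in> I \<Longrightarrow> y \<otimes> x \<in> I"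
    using I unfolding semigroup_ideal_def set_mult_def by blast+
  have "z \<in> I" using sub l[OF zero_in] by fastforce
  moreover have "carrier Q \<subseteq> I" if y: "y \<in> I" "y \<noteq> z" for y
  proof
    fix x assume x: "x \<in> carrier Q"
    show "x \<in> I"
    proof (cases "x = z")
      case False
      have yc: "y \<in> carrier Q" using y sub by auto
      obtain c where c: "c \<in> carrier Q" "x \<otimes> (c \<otimes> y) \<noteq> z"
        using connected[OF x yc False y(2)] by blast
      have "x \<otimes> ((c \<otimes> y) \<otimes> i (c \<otimes> y)) = x" using cancel_inv[of x "c \<otimes> y"] c x yc by simp
      moreover have "x \<otimes> ((c \<otimes> y) \<otimes> i (c \<otimes> y)) \<in> I"
        by (intro l r inv_in closed x c y yc)
      ultimately show ?thesis by simp
    qed (use \<open>z \<in> I\<close> in simp)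
  qed
  ultimately show ?thesis using sub by blast
qed

text \<open>If \<open>f\<close> is a nonzero idempotent below \<open>e\<close>, then
  \<open>f f = f = e f\<close>, and cancelling \<open>f\<close> on the right gives
  \<open>f = e\<close>.\<close>

lemma primitive:
  assumes "idempotent Q e" "e \<noteq> z"
  shows "primitive_idempotent Q z e"
  using assms right_cancel unfolding primitive_idempotent_def idempotent_def by metis

lemma brandt_semigroup: "brandt_semigroup Q"
proof -
  have sg: "is_semigroup Q" and zero: "is_zero Q z"
    using zero_semigroup_axioms unfolding zero_semigroup_iff by blast+
  obtain x where x: "x \<in> carrier Q" "x \<noteq> z" using nontrivial by blast
  have "x \<otimes> i x \<in> carrier Q <#> carrier Q" using x unfolding set_mult_def by blast
  then have "carrier Q <#> carrier Q \<noteq> {z}" using mult_inv_nonzero[OF x] by auto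
  then have "zero_simple Q z" unfolding zero_simple_def using sg zero ideal_trivial by blast
  moreover have "primitive_idempotent Q z (x \<otimes> i x)"
    by (rule primitive) (use x mult_inv_nonzero in \<open>auto simp: idempotent_def assoc inv_inner\<close>)
  moreover have "inverse_semigroup Q"
    unfolding inverse_semigroup_def using sg is_inverse_inv inverse_unique by blast
  ultimately show ?thesis unfolding brandt_semigroup_def completely_zero_simple_def by blast
qed

end

section \<open>Completely 0-simple inverse semigroups satisfy the groupoid laws\<close>

locale inv_semigroup = zero_semigroup +
  assumes inverse: "inverse_semigroup Q"
begin

lemma sinv_inverse: "x \<in> carrier Q \<Longrightarrow> is_inverse Q x (sinv Q x)"
  using inverse theI'[of "is_inverse Q x"] unfolding inverse_semigroup_def sinv_def by blast

lemma sinv_in [simp, intro]: "x \<in> carrier Q \<Longrightarrow> sinv Q x \<in> carrier Q"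
  using sinv_inverse unfolding is_inverse_def by blast

lemma sinv_outer: "x \<in> carrier Q \<Longrightarrow> x \<otimes> (sinv Q x \<otimes> x) = x"
  using sinv_inverse[of x] unfolding is_inverse_def by (simp add: assoc)

lemma sinv_inner: "x \<in> carrier Q \<Longrightarrow> sinv Q x \<otimes> (x \<otimes> sinv Q x) = sinv Q x"
  using sinv_inverse[of x] unfolding is_inverse_def by (simp add: assoc)

lemma is_inverse_unique: "x \<in> carrier Q \<Longrightarrow> is_inverse Q x y \<Longrightarrow> is_inverse Q x w \<Longrightarrow> y = w"
  using inverse unfolding inverse_semigroup_def by blast

lemma idempotent_simps:
  assumes "idempotent Q e"
  shows "e \<in> carrier Q" "e \<otimes> e = e" "w \<in> carrier Q \<Longrightarrow> e \<otimes> (e \<otimes> w) = e \<otimes> w"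
  using assms assoc[of e e w] unfolding idempotent_def by auto

text \<open>The classical argument: if \<open>x\<close> is the inverse of \<open>e f\<close>, then
  so is \<open>f x e\<close>. Uniqueness gives \<open>x = f x e\<close>, which makes
  \<open>x\<close> idempotent and hence its own inverse; but \<open>e f\<close> is an inverse of
  \<open>x\<close> too.\<close>

lemma idempotent_mult:
  assumes e: "idempotent Q e" and f: "idempotent Q f"
  shows "idempotent Q (e \<otimes> f)"
proof -
  note ef = idempotent_simps[OF e] idempotent_simps[OF f]
  define x where "x = sinv Q (e \<otimes> f)"
  have x: "x \<in> carrier Q" "(e \<otimes> f) \<otimes> x \<otimes> (e \<otimes> f) = e \<otimes> f" "x \<otimes> (e \<otimes> f) \<otimes> x = x"
    using sinv_inverse[of "e \<otimes> f"] ef unfolding is_inverse_def x_def by auto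
  have x1: "e \<otimes> (f \<otimes> (x \<otimes> (e \<otimes> f))) = e \<otimes> f"
    and x2: "x \<otimes> (e \<otimes> (f \<otimes> x)) = x"
    using x ef by (simp_all add: assoc)
  have x3: "x \<otimes> (e \<otimes> (f \<otimes> (x \<otimes> e))) = x \<otimes> e"
    using arg_cong[OF x2, of "\<lambda>t. t \<otimes> e"] ef x by (simp add: assoc)
  have "is_inverse Q (e \<otimes> f) (f \<otimes> (x \<otimes> e))"
    unfolding is_inverse_def using x ef x1 x3 by (simp add: assoc)
  moreover have "is_inverse Q (e \<otimes> f) x"
    unfolding is_inverse_def using x by simp
  ultimately have eq: "x = f \<otimes> (x \<otimes> e)" using is_inverse_unique ef by blast
  have "x \<otimes> x = (f \<otimes> (x \<otimes> e)) \<otimes> (f \<otimes> (x \<otimes> e))"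
    by (rule arg_cong2[OF eq eq])
  also have "\<dots> = f \<otimes> (x \<otimes> (e \<otimes> (f \<otimes> (x \<otimes> e))))"
    using ef x(1) by (simp add: assoc)
  also have "\<dots> = x" unfolding x3 by (rule eq[symmetric])
  finally have idx: "x \<otimes> x = x" .
  have "is_inverse Q x x" unfolding is_inverse_def using x idx by simp
  moreover have "is_inverse Q x (e \<otimes> f)"
    unfolding is_inverse_def using x ef by simp
  ultimately have "x = e \<otimes> f" using is_inverse_unique x by blast
  then show ?thesis using x idx unfolding idempotent_def by simp
qed

text \<open>Both \<open>e f\<close> and \<open>f e\<close> are inverses of
  \<open>e f\<close>.\<close>

lemma idempotent_commute:
  assumes e: "idempotent Q e" and f: "idempotent Q f"
  shows "e \<otimes> f = f \<otimes> e"
proof -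
  note ef = idempotent_simps[OF e] idempotent_simps[OF f]
  note ef' = idempotent_simps[OF idempotent_mult[OF e f]]
    idempotent_simps[OF idempotent_mult[OF f e]]
  have "is_inverse Q (e \<otimes> f) (e \<otimes> f)" unfolding is_inverse_def using ef' by simp
  moreover have "is_inverse Q (e \<otimes> f) (f \<otimes> e)"
    unfolding is_inverse_def using ef ef' by (simp add: assoc)
  ultimately show ?thesis using is_inverse_unique ef by blast
qed

end

locale completely_zero_simple_inverse = inv_semigroup +
  assumes simple: "zero_simple Q z" and prim: "\<exists>e. primitive_idempotent Q z e"
begin

text \<open>The set of all \<open>u x v\<close> is an ideal, and it contains \<open>x\<close>
  itself, so 0-simplicity makes it the whole carrier.\<close>

lemma factor_through:
  assumes x: "x \<in> carrier Q" "x \<noteq> z" and y: "y \<in> carrier Q"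
  shows "\<exists>u\<in>carrier Q. \<exists>v\<in>carrier Q. y = u \<otimes> (x \<otimes> v)"
proof -
  let ?I = "{u \<otimes> (x \<otimes> v) | u v. u \<in> carrier Q \<and> v \<in> carrier Q}"
  have l: "w \<otimes> (u \<otimes> (x \<otimes> v)) \<in> ?I" "(u \<otimes> (x \<otimes> v)) \<otimes> w \<in> ?I"
    if "w \<in> carrier Q" "u \<in> carrier Q" "v \<in> carrier Q" for w u v
  proof -
    have "w \<otimes> (u \<otimes> (x \<otimes> v)) = (w \<otimes> u) \<otimes> (x \<otimes> v)" "(u \<otimes> (x \<otimes> v)) \<otimes> w = u \<otimes> (x \<otimes> (v \<otimes> w))"
      using that x by (simp_all add: assoc)
    then show "w \<otimes> (u \<otimes> (x \<otimes> v)) \<in> ?I" "(u \<otimes> (x \<otimes> v)) \<otimes> w \<in> ?I" using that by blast+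
  qed
  have "semigroup_ideal Q ?I"
    unfolding semigroup_ideal_def
  proof (intro conjI)
    show "?I \<noteq> {}" using zero_in by blast
    show "?I \<subseteq> carrier Q" using x by auto
    show "carrier Q <#> ?I \<subseteq> ?I" "?I <#> carrier Q \<subseteq> ?I"
      unfolding set_mult_def using l by blast+
  qed
  then have "?I = {z} \<or> ?I = carrier Q" using simple unfolding zero_simple_def by blast
  moreover have "x = (x \<otimes> sinv Q x) \<otimes> (x \<otimes> (sinv Q x \<otimes> x))"
    using x by (simp add: assoc sinv_outer)
  then have "x \<in> ?I" using x by blast
  ultimately show ?thesis using x y by blast
qed

text \<open>One primitive idempotent \<open>e\<close> suffices. Factoring \<open>f\<close> through
  \<open>e\<close> gives \<open>u\<close> and \<open>v\<close> with \<open>v u = f\<close>, and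
  \<open>g \<mapsto> u g v\<close> carries the nonzero idempotents below \<open>f\<close> to nonzero
  idempotents below \<open>e\<close>, hence all to \<open>e\<close>. Recovering \<open>h\<close> as
  \<open>v (u h v) u\<close> yields \<open>f\<close>.\<close>

lemma all_primitive:
  assumes f: "idempotent Q f" "f \<noteq> z" and h: "idempotent Q h" "h \<noteq> z" "f \<otimes> h = h" "h \<otimes> f = h"
  shows "h = f"
proof -
  obtain e where e: "idempotent Q e" "e \<noteq> z"
    and e_min: "\<And>g. idempotent Q g \<Longrightarrow> g \<noteq> z \<Longrightarrow> e \<otimes> g = g \<Longrightarrow> g \<otimes> e = g \<Longrightarrow> g = e"
    using prim unfolding primitive_idempotent_def by blast
  note E = idempotent_simps[OF e(1)] and F = idempotent_simps[OF f(1)] and H = idempotent_simps[OF h(1)]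
  obtain x y where xy: "x \<in> carrier Q" "y \<in> carrier Q" "f = x \<otimes> (e \<otimes> y)"
    using factor_through E F e by metis
  define u v where "u = e \<otimes> (y \<otimes> f)" and "v = f \<otimes> (x \<otimes> e)"
  have uv: "u \<in> carrier Q" "v \<in> carrier Q" unfolding u_def v_def using xy E F by auto
  have "v \<otimes> u = f \<otimes> ((x \<otimes> (e \<otimes> y)) \<otimes> f)"
    unfolding u_def v_def using xy(1,2) E F by (simp add: assoc)
  then have vu: "v \<otimes> u = f" unfolding xy(3)[symmetric] using F by simp
  have uf: "u \<otimes> f = u" "f \<otimes> v = v" "e \<otimes> u = u" "v \<otimes> e = v"
    unfolding u_def v_def using xy(1,2) E F by (simp_all add: assoc)
  have below: "u \<otimes> (g \<otimes> v) = e" if g: "idempotent Q g" "g \<noteq> z" "f \<otimes> g = g" "g \<otimes> f = g" for g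
  proof (rule e_min)
    note G = idempotent_simps[OF g(1)]
    have "(u \<otimes> (g \<otimes> v)) \<otimes> (u \<otimes> (g \<otimes> v)) = u \<otimes> (g \<otimes> ((v \<otimes> u) \<otimes> (g \<otimes> v)))"
      using uv G by (simp add: assoc)
    also have "\<dots> = u \<otimes> (g \<otimes> ((f \<otimes> g) \<otimes> v))" using uv G F by (simp add: vu assoc)
    also have "\<dots> = u \<otimes> (g \<otimes> v)" using uv G g by simp
    finally show "idempotent Q (u \<otimes> (g \<otimes> v))" unfolding idempotent_def using uv G by simp
    have "v \<otimes> ((u \<otimes> (g \<otimes> v)) \<otimes> u) = (v \<otimes> u) \<otimes> (g \<otimes> (v \<otimes> u))"
      using uv G by (simp add: assoc)
    also have "\<dots> = g" using vu g by simp
    finally show "u \<otimes> (g \<otimes> v) \<noteq> z" using g(2) uv mult_zero zero_mult by metis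
    show "e \<otimes> (u \<otimes> (g \<otimes> v)) = u \<otimes> (g \<otimes> v)" "(u \<otimes> (g \<otimes> v)) \<otimes> e = u \<otimes> (g \<otimes> v)"
      using uf uv G E assoc[of e u "g \<otimes> v"] by (simp_all add: assoc)
  qed
  have "h = (v \<otimes> u) \<otimes> (h \<otimes> (v \<otimes> u))" using vu h by simp
  also have "\<dots> = v \<otimes> ((u \<otimes> (h \<otimes> v)) \<otimes> u)" using uv H by (simp add: assoc)
  also have "\<dots> = f" using below[OF h] uf vu by simp
  finally show ?thesis .
qed

text \<open>In groupoid terms, a nonzero product requires the target of \<open>x\<close> to be the
  source of \<open>y\<close>. Call the two sides e and f: since x y = x (e f) y, the idempotent e f
  is nonzero; it lies below both e and f, and both are primitive.\<close>

lemma mult_idempotents: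
  assumes x: "x \<in> carrier Q" and y: "y \<in> carrier Q" and xy: "x \<otimes> y \<noteq> z"
  shows "sinv Q x \<otimes> x = y \<otimes> sinv Q y"
proof -
  let ?e = "sinv Q x \<otimes> x" and ?f = "y \<otimes> sinv Q y"
  have e: "idempotent Q ?e" and f: "idempotent Q ?f"
    unfolding idempotent_def using x y by (simp_all add: assoc sinv_outer sinv_inner)
  note E = idempotent_simps[OF e] and F = idempotent_simps[OF f]
  have ef: "idempotent Q (?e \<otimes> ?f)" by (rule idempotent_mult[OF e f])
  have "x \<otimes> ((?e \<otimes> ?f) \<otimes> y) = (x \<otimes> ?e) \<otimes> (y \<otimes> (sinv Q y \<otimes> y))"
    using x y by (simp add: assoc)
  then have "x \<otimes> ((?e \<otimes> ?f) \<otimes> y) = x \<otimes> y" using x y sinv_outer by simp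
  then have nz: "?e \<otimes> ?f \<noteq> z" using xy x y mult_zero zero_mult by metis
  then have nz': "?e \<noteq> z" "?f \<noteq> z" using E(1) F(1) zero_mult mult_zero by metis+
  have c: "?e \<otimes> ?f = ?f \<otimes> ?e" by (rule idempotent_commute[OF e f])
  have absorb: "?e \<otimes> (?e \<otimes> ?f) = ?e \<otimes> ?f" "(?e \<otimes> ?f) \<otimes> ?f = ?e \<otimes> ?f"
    using E F assoc[of ?e ?f ?f] by simp_all
  have absorb': "(?e \<otimes> ?f) \<otimes> ?e = ?e \<otimes> ?f" "?f \<otimes> (?e \<otimes> ?f) = ?e \<otimes> ?f"
    unfolding c using E F assoc[of ?f ?e ?e] by simp_all
  have "?e \<otimes> ?f = ?e" by (rule all_primitive[OF e nz'(1) ef nz absorb(1) absorb'(1)])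
  moreover have "?e \<otimes> ?f = ?f" by (rule all_primitive[OF f nz'(2) ef nz absorb'(2) absorb(2)])
  ultimately show ?thesis by simp
qed

sublocale brandt Q z "sinv Q"
proof
  fix x y assume x: "x \<in> carrier Q" and y: "y \<in> carrier Q" and xy: "x \<otimes> y \<noteq> z"
  have "sinv Q x \<otimes> (x \<otimes> y) = (sinv Q x \<otimes> x) \<otimes> y" using x y by (simp add: assoc)
  then show "sinv Q x \<otimes> (x \<otimes> y) = y"
    unfolding mult_idempotents[OF x y xy] using y by (simp add: assoc sinv_outer)
  show "x \<otimes> (y \<otimes> sinv Q y) = x"
    unfolding mult_idempotents[OF x y xy, symmetric] using x by (simp add: sinv_outer)
next
  fix x y assume x: "x \<in> carrier Q" and y: "y \<in> carrier Q" and nz: "x \<noteq> z" "y \<noteq> z"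
  \<comment> \<open>0-simplicity factors the inverse of \<open>x\<close> through \<open>y\<close>.
    Then \<open>x = x (sinv Q x) x\<close> has the left factor \<open>x u y\<close>, which must be
    nonzero, so \<open>u\<close> is the connecting element.\<close>
  obtain u v where uv: "u \<in> carrier Q" "v \<in> carrier Q" "sinv Q x = u \<otimes> (y \<otimes> v)"
    using factor_through[OF y nz(2) sinv_in[OF x]] by blast
  have "x \<otimes> ((u \<otimes> (y \<otimes> v)) \<otimes> x) = (x \<otimes> (u \<otimes> y)) \<otimes> (v \<otimes> x)"
    using uv(1,2) x y by (simp add: assoc)
  then have "(x \<otimes> (u \<otimes> y)) \<otimes> (v \<otimes> x) = x" using sinv_outer[OF x] uv(3) by simp
  then have "x \<otimes> (u \<otimes> y) \<noteq> z" using nz uv x closed zero_mult by metis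
  then show "\<exists>c\<in>carrier Q. x \<otimes> (c \<otimes> y) \<noteq> z" using uv by blast
qed (simp_all add: sinv_outer sinv_inner)

end

lemma brandt_semigroup_imp:
  assumes "brandt_semigroup Q"
  shows "\<exists>z. brandt Q z (sinv Q)"
proof -
  obtain z where z: "zero_simple Q z" "\<exists>e. primitive_idempotent Q z e"
    using assms unfolding brandt_semigroup_def completely_zero_simple_def by blast
  have "zero_semigroup Q z" using z(1) unfolding zero_simple_def zero_semigroup_iff by blast
  then interpret completely_zero_simple_inverse Q z
    using z assms unfolding brandt_semigroup_def
    by (simp add: completely_zero_simple_inverse.intro completely_zero_simple_inverse_axioms.intro
        inv_semigroup.intro inv_semigroup_axioms.intro)
  show ?thesis using brandt_axioms by blast
qed

section \<open>Left I-orders in Brandt semigroups\<close>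

lemma R_starI:
  assumes "a \<in> carrier S" "b \<in> carrier S"
    and "\<And>x y. x \<in> carrier S \<Longrightarrow> y \<in> carrier S \<Longrightarrow>
      x \<otimes>\<^bsub>S\<^esub> a = y \<otimes>\<^bsub>S\<^esub> a \<longleftrightarrow> x \<otimes>\<^bsub>S\<^esub> b = y \<otimes>\<^bsub>S\<^esub> b"
    and "\<And>x. x \<in> carrier S \<Longrightarrow> x \<otimes>\<^bsub>S\<^esub> a = a \<longleftrightarrow> x \<otimes>\<^bsub>S\<^esub> b = b"
  shows "(a, b) \<in> R_star S"
proof -
  have "a = x \<otimes>\<^bsub>S\<^esub> a \<longleftrightarrow> b = x \<otimes>\<^bsub>S\<^esub> b" if "x \<in> carrier S" for x
    using assms(4)[OF that] by metis
  then show ?thesis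
    using assms unfolding R_star_def by (auto simp: adjoin_one_def)
qed

lemma R_starD:
  assumes "(a, b) \<in> R_star S" "x \<in> carrier S" "y \<in> carrier S"
  shows "x \<otimes>\<^bsub>S\<^esub> a = y \<otimes>\<^bsub>S\<^esub> a \<longleftrightarrow> x \<otimes>\<^bsub>S\<^esub> b = y \<otimes>\<^bsub>S\<^esub> b"
proof -
  have "Some x \<in> carrier (adjoin_one S)" "Some y \<in> carrier (adjoin_one S)"
    using assms unfolding adjoin_one_def by auto
  moreover have "Some u \<otimes>\<^bsub>adjoin_one S\<^esub> Some v = Some (u \<otimes>\<^bsub>S\<^esub> v)" for u v
    unfolding adjoin_one_def by simp
  ultimately show ?thesis using assms(1) unfolding R_star_def by fastforce
qed

text \<open>The zero always lies in the intersection of the two left ideals, so differing from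
  \<open>{z}\<close> means having a nonzero common left multiple.\<close>

lemma lambda_rel_iff:
  assumes "zero_semigroup S z"
  shows "(a, b) \<in> lambda_rel S z \<longleftrightarrow> a \<in> carrier S \<and> b \<in> carrier S \<and>
    (a = z \<and> b = z \<or>
     (\<exists>x\<in>carrier S. \<exists>y\<in>carrier S. x \<otimes>\<^bsub>S\<^esub> a = y \<otimes>\<^bsub>S\<^esub> b \<and> y \<otimes>\<^bsub>S\<^esub> b \<noteq> z))"
proof -
  interpret zero_semigroup S z by (rule assms)
  have "(carrier S #>\<^bsub>S\<^esub> a) \<inter> (carrier S #>\<^bsub>S\<^esub> b) \<noteq> {z} \<longleftrightarrow>
     (\<exists>x\<in>carrier S. \<exists>y\<in>carrier S. x \<otimes>\<^bsub>S\<^esub> a = y \<otimes>\<^bsub>S\<^esub> b \<and> y \<otimes>\<^bsub>S\<^esub> b \<noteq> z)"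
    (is "?L \<noteq> {z} \<longleftrightarrow> ?R") if "a \<in> carrier S" "b \<in> carrier S"
  proof -
    have "z \<in> ?L" using that zero_mult zero_in unfolding Int_iff r_coset_iff by metis
    then have "?L \<noteq> {z} \<longleftrightarrow> (\<exists>w\<in>?L. w \<noteq> z)" by blast
    also have "\<dots> \<longleftrightarrow> ?R" unfolding Bex_def Int_iff r_coset_iff by metis
    finally show ?thesis .
  qed
  then show ?thesis unfolding lambda_rel_def by blast
qed

text \<open>The inverse is a parameter \<open>i\<close>, so that the same results serve a given
  \<open>Q\<close> with \<open>sinv Q\<close> and a constructed one with an explicit inverse such as
  \<open>converse\<close>.\<close>

locale left_order_in_brandt = brandt Q z i
  for Q :: "('a, 'b) monoid_scheme" (structure) and z :: 'a and i :: "'a \<Rightarrow> 'a" +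
  fixes S :: "('s, 'c) monoid_scheme" and \<phi> :: "'s \<Rightarrow> 'a"
  assumes semigroup: "is_semigroup S"
    and hom: "\<phi> \<in> hom S Q"
    and inj: "inj_on \<phi> (carrier S)"
    and fraction: "q \<in> carrier Q \<Longrightarrow> \<exists>a\<in>carrier S. \<exists>b\<in>carrier S. q = i (\<phi> a) \<otimes> \<phi> b"
begin

section \<open>Necessity of the conditions\<close>

lemma phi_in [simp, intro]: "a \<in> carrier S \<Longrightarrow> \<phi> a \<in> carrier Q"
  using hom unfolding hom_def by blast

lemma phi_mult: "a \<in> carrier S \<Longrightarrow> b \<in> carrier S \<Longrightarrow> \<phi> (a \<otimes>\<^bsub>S\<^esub> b) = \<phi> a \<otimes> \<phi> b"
  using hom unfolding hom_def by blast

lemma S_closed [simp, intro]: "a \<in> carrier S \<Longrightarrow> b \<in> carrier S \<Longrightarrow> a \<otimes>\<^bsub>S\<^esub> b \<in> carrier S"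
  using semigroup unfolding is_semigroup_def by blast

lemma phi_eq_iff: "a \<in> carrier S \<Longrightarrow> b \<in> carrier S \<Longrightarrow> \<phi> a = \<phi> b \<longleftrightarrow> a = b"
  using inj unfolding inj_on_def by blast

text \<open>Write the zero as a^-1 b. If a a is nonzero, then a (a a^-1) = a, whence a b = a a (a^-1
  b) = 0. So a a or a b is a zero in the image.\<close>

lemma zero_in_image: "\<exists>a\<in>carrier S. \<phi> a = z"
proof -
  obtain a b where ab: "a \<in> carrier S" "b \<in> carrier S" "i (\<phi> a) \<otimes> \<phi> b = z"
    using fraction[OF zero_in] by metis
  have "\<phi> a \<otimes> \<phi> a = z \<or> \<phi> a \<otimes> \<phi> b = z"
  proof (rule ccontr)
    assume "\<not> ?thesis"
    then have "\<phi> a \<otimes> (\<phi> a \<otimes> i (\<phi> a)) = \<phi> a" "\<phi> a \<otimes> \<phi> b \<noteq> z"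
      using cancel_inv ab by auto
    moreover have "\<phi> a \<otimes> (\<phi> a \<otimes> (i (\<phi> a) \<otimes> \<phi> b)) = (\<phi> a \<otimes> (\<phi> a \<otimes> i (\<phi> a))) \<otimes> \<phi> b"
      using ab by (simp add: assoc)
    ultimately show False using ab by simp
  qed
  then show ?thesis using ab phi_mult S_closed by metis
qed

definition zS :: 's where "zS = (SOME a. a \<in> carrier S \<and> \<phi> a = z)"

lemma zS: "zS \<in> carrier S" "\<phi> zS = z"
  using someI_ex[of "\<lambda>a. a \<in> carrier S \<and> \<phi> a = z"] zero_in_image unfolding zS_def by auto

lemma phi_eq_zero: "a \<in> carrier S \<Longrightarrow> \<phi> a = z \<longleftrightarrow> a = zS"
  using zS phi_eq_iff by metis

lemma is_zero_zS: "is_zero S zS"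
proof -
  have "carrier S \<noteq> {zS}"
  proof
    assume "carrier S = {zS}"
    then have "q = z" if "q \<in> carrier Q" for q using fraction[OF that] zS by auto
    then show False using nontrivial zero_in by blast
  qed
  moreover have "zS \<otimes>\<^bsub>S\<^esub> x = zS \<and> x \<otimes>\<^bsub>S\<^esub> zS = zS" if "x \<in> carrier S" for x
    using that zS phi_eq_zero phi_mult S_closed mult_zero zero_mult phi_in by metis
  ultimately show ?thesis unfolding is_zero_def using zS by blast
qed

lemma zero_semigroup_S: "zero_semigroup S zS"
  unfolding zero_semigroup_iff using semigroup is_zero_zS by blast

lemma mult_eq_zero:
  "a \<in> carrier S \<Longrightarrow> b \<in> carrier S \<Longrightarrow> a \<otimes>\<^bsub>S\<^esub> b = zS \<longleftrightarrow> \<phi> a \<otimes> \<phi> b = z"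
  using phi_eq_zero phi_mult S_closed by metis

lemma categorical_S: "categorical_at_zero S zS"
  unfolding categorical_at_zero_def
proof (intro ballI impI)
  fix a b c assume "a \<in> carrier S" "b \<in> carrier S" "c \<in> carrier S"
    "a \<otimes>\<^bsub>S\<^esub> b \<noteq> zS \<and> b \<otimes>\<^bsub>S\<^esub> c \<noteq> zS"
  then show "a \<otimes>\<^bsub>S\<^esub> b \<otimes>\<^bsub>S\<^esub> c \<noteq> zS"
    using categorical[of "\<phi> a" "\<phi> b" "\<phi> c"] by (simp add: mult_eq_zero phi_mult assoc)
qed

lemma zero_cancellative_S: "zero_cancellative S zS"
  unfolding zero_cancellative_def
proof (intro ballI conjI impI)
  fix a b c assume abc: "a \<in> carrier S" "b \<in> carrier S" "c \<in> carrier S"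
  show "b = c" if "a \<otimes>\<^bsub>S\<^esub> b = a \<otimes>\<^bsub>S\<^esub> c \<and> a \<otimes>\<^bsub>S\<^esub> c \<noteq> zS"
    using that abc left_cancel[of "\<phi> a" "\<phi> b" "\<phi> c"] mult_eq_zero phi_mult phi_eq_iff phi_in by metis
  show "b = c" if "b \<otimes>\<^bsub>S\<^esub> a = c \<otimes>\<^bsub>S\<^esub> a \<and> c \<otimes>\<^bsub>S\<^esub> a \<noteq> zS"
    using that abc right_cancel[of "\<phi> a" "\<phi> b" "\<phi> c"] mult_eq_zero phi_mult phi_eq_iff phi_in by metis
qed

text \<open>Both sides say that a and b have the same target. From x a = y b one gets x (a b^-1) =
  y; conversely, writing a b^-1 as a left fraction x^-1 y and clearing denominators gives x a = y b.
  This is where the Ore condition comes from.\<close>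

lemma common_multiple_iff:
  assumes a: "a \<in> carrier S" and b: "b \<in> carrier S"
  shows "(\<exists>x\<in>carrier S. \<exists>y\<in>carrier S. x \<otimes>\<^bsub>S\<^esub> a = y \<otimes>\<^bsub>S\<^esub> b \<and> y \<otimes>\<^bsub>S\<^esub> b \<noteq> zS)
    \<longleftrightarrow> \<phi> a \<otimes> i (\<phi> b) \<noteq> z"
proof
  assume "\<exists>x\<in>carrier S. \<exists>y\<in>carrier S. x \<otimes>\<^bsub>S\<^esub> a = y \<otimes>\<^bsub>S\<^esub> b \<and> y \<otimes>\<^bsub>S\<^esub> b \<noteq> zS"
  then obtain x y where xy: "x \<in> carrier S" "y \<in> carrier S" "\<phi> x \<otimes> \<phi> a = \<phi> y \<otimes> \<phi> b"
    "\<phi> y \<otimes> \<phi> b \<noteq> z"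
    using a b phi_mult mult_eq_zero by metis
  have "\<phi> x \<otimes> (\<phi> a \<otimes> i (\<phi> b)) = (\<phi> x \<otimes> \<phi> a) \<otimes> i (\<phi> b)"
    using xy(1) a b by (simp add: assoc)
  also have "\<dots> = \<phi> y"
    unfolding xy(3) using xy cancel_inv a b by (simp add: assoc)
  finally have "\<phi> x \<otimes> (\<phi> a \<otimes> i (\<phi> b)) = \<phi> y" .
  moreover have "\<phi> y \<noteq> z" using xy b zero_mult phi_in by metis
  ultimately show "\<phi> a \<otimes> i (\<phi> b) \<noteq> z" using mult_zero xy(1) phi_in by metis
next
  assume nz: "\<phi> a \<otimes> i (\<phi> b) \<noteq> z"
  obtain x y where xy: "x \<in> carrier S" "y \<in> carrier S" "\<phi> a \<otimes> i (\<phi> b) = i (\<phi> x) \<otimes> \<phi> y"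
    using fraction[of "\<phi> a \<otimes> i (\<phi> b)"] a b by auto
  have "i (i (\<phi> x)) \<otimes> (i (\<phi> x) \<otimes> \<phi> y) = \<phi> y"
    by (rule inv_cancel) (use xy nz in simp_all)
  then have y: "\<phi> x \<otimes> (\<phi> a \<otimes> i (\<phi> b)) = \<phi> y" using xy inv_inv by simp
  have "\<phi> y \<noteq> z" using xy nz mult_zero phi_in inv_in by metis
  have "\<phi> a \<otimes> (i (\<phi> b) \<otimes> i (i (\<phi> b))) = \<phi> a"
    by (rule cancel_inv) (use a b nz in simp_all)
  then have "\<phi> x \<otimes> \<phi> a = (\<phi> x \<otimes> (\<phi> a \<otimes> i (\<phi> b))) \<otimes> \<phi> b"
    using xy(1) a b inv_inv by (simp add: assoc)
  then have eq: "\<phi> x \<otimes> \<phi> a = \<phi> y \<otimes> \<phi> b" unfolding y .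
  have "\<phi> x \<otimes> \<phi> a \<noteq> z"
  proof
    assume "\<phi> x \<otimes> \<phi> a = z"
    then have "\<phi> x \<otimes> (\<phi> a \<otimes> i (\<phi> b)) = z"
      using assoc[of "\<phi> x" "\<phi> a" "i (\<phi> b)"] xy(1) a b by simp
    then show False using y \<open>\<phi> y \<noteq> z\<close> by simp
  qed
  then have "x \<otimes>\<^bsub>S\<^esub> a = y \<otimes>\<^bsub>S\<^esub> b" "y \<otimes>\<^bsub>S\<^esub> b \<noteq> zS"
    using eq xy a b by (simp_all add: mult_eq_zero phi_mult flip: phi_eq_iff)
  then show "\<exists>x\<in>carrier S. \<exists>y\<in>carrier S. x \<otimes>\<^bsub>S\<^esub> a = y \<otimes>\<^bsub>S\<^esub> b \<and> y \<otimes>\<^bsub>S\<^esub> b \<noteq> zS"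
    using xy by blast
qed

lemma lambda_iff: "(a, b) \<in> lambda_rel S zS \<longleftrightarrow>
    a \<in> carrier S \<and> b \<in> carrier S \<and> (a = zS \<and> b = zS \<or> \<phi> a \<otimes> i (\<phi> b) \<noteq> z)"
  unfolding lambda_rel_iff[OF zero_semigroup_S] using common_multiple_iff by blast

text \<open>By \<open>lambda_iff\<close>, nonzero elements are related when a b^-1 is nonzero.
  Categoricity applied to a, b^-1 and b c^-1 gives the claim, since b^-1 (b c^-1) = c^-1.\<close>

lemma trans_lambda: "trans (lambda_rel S zS)"
proof (rule transI)
  fix a b c assume ab: "(a, b) \<in> lambda_rel S zS" and bc: "(b, c) \<in> lambda_rel S zS"
  then have car: "a \<in> carrier S" "b \<in> carrier S" "c \<in> carrier S" by (auto simp: lambda_iff)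
  show "(a, c) \<in> lambda_rel S zS"
  proof (cases "b = zS")
    case True
    then show ?thesis using ab bc car zS by (auto simp: lambda_iff)
  next
    case False
    then have nz: "\<phi> a \<otimes> i (\<phi> b) \<noteq> z" "\<phi> b \<otimes> i (\<phi> c) \<noteq> z"
      using ab bc by (auto simp: lambda_iff)
    have "i (\<phi> b) \<otimes> (\<phi> b \<otimes> i (\<phi> c)) = i (\<phi> c)"
      by (rule inv_cancel) (use car nz in simp_all)
    moreover have "i (\<phi> c) \<noteq> z" using nz car mult_zero phi_in by metis
    then have "\<phi> a \<otimes> (i (\<phi> b) \<otimes> (\<phi> b \<otimes> i (\<phi> c))) \<noteq> z"
      using categorical[of "\<phi> a" "i (\<phi> b)" "\<phi> b \<otimes> i (\<phi> c)"] car nz calculation by simp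
    ultimately show ?thesis using car by (simp add: lambda_iff)
  qed
qed

lemma left_multiples_nonzero:
  assumes "a \<in> carrier S" "a \<noteq> zS"
  shows "carrier S #>\<^bsub>S\<^esub> a \<noteq> {zS}"
proof -
  have "\<phi> a \<otimes> i (\<phi> a) \<noteq> z" by (rule mult_inv_nonzero) (use assms phi_eq_zero in auto)
  then obtain y where "y \<in> carrier S" "y \<otimes>\<^bsub>S\<^esub> a \<noteq> zS" using common_multiple_iff assms by metis
  moreover from this have "y \<otimes>\<^bsub>S\<^esub> a \<in> carrier S #>\<^bsub>S\<^esub> a" unfolding r_coset_iff by blast
  ultimately show ?thesis by blast
qed

text \<open>With w = a^-1 b one has b = a w and a = b w^-1, so right multiplication by w and w^-1
  carries equations between left multiples of a to those of b and back.\<close>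

lemma R_starI_fraction:
  assumes a: "a \<in> carrier S" and b: "b \<in> carrier S" and nz: "i (\<phi> a) \<otimes> \<phi> b \<noteq> z"
  shows "(a, b) \<in> R_star S"
proof -
  let ?w = "i (\<phi> a) \<otimes> \<phi> b"
  have 1: "\<phi> a \<otimes> ?w = \<phi> b"
    using inv_cancel[of "i (\<phi> a)" "\<phi> b"] a b nz inv_inv by simp
  have 2: "\<phi> b \<otimes> i ?w = \<phi> a"
    using inv_cancel[of "i (\<phi> b)" "\<phi> a"] a b nz inv_inv inv_mult[of "i (\<phi> a)" "\<phi> b"] inv_eq_zero[of ?w]
    by simp
  have transfer: "u \<otimes>\<^bsub>S\<^esub> b = u' \<otimes>\<^bsub>S\<^esub> b \<longleftrightarrow> u \<otimes>\<^bsub>S\<^esub> a = u' \<otimes>\<^bsub>S\<^esub> a"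
    if u: "u \<in> carrier S" "u' \<in> carrier S" for u u'
  proof -
    have "\<phi> u \<otimes> \<phi> b = \<phi> u' \<otimes> \<phi> b \<longleftrightarrow> \<phi> u \<otimes> \<phi> a = \<phi> u' \<otimes> \<phi> a"
      using 1 2 a b u assoc[of "\<phi> u" "\<phi> a" ?w] assoc[of "\<phi> u'" "\<phi> a" ?w]
        assoc[of "\<phi> u" "\<phi> b" "i ?w"] assoc[of "\<phi> u'" "\<phi> b" "i ?w"]
      by (metis closed inv_in phi_in)
    then show ?thesis using u a b by (simp add: phi_mult flip: phi_eq_iff)
  qed
  have transfer1: "u \<otimes>\<^bsub>S\<^esub> a = a \<longleftrightarrow> u \<otimes>\<^bsub>S\<^esub> b = b" if u: "u \<in> carrier S" for u
  proof -
    have "\<phi> u \<otimes> \<phi> a = \<phi> a \<longleftrightarrow> \<phi> u \<otimes> \<phi> b = \<phi> b"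
      using 1 2 a b u assoc[of "\<phi> u" "\<phi> a" ?w] assoc[of "\<phi> u" "\<phi> b" "i ?w"]
      by (metis closed inv_in phi_in)
    then show ?thesis using u a b by (simp add: phi_mult flip: phi_eq_iff)
  qed
  show ?thesis by (rule R_starI[OF a b]) (use transfer transfer1 in blast)+
qed

text \<open>Connectedness of \<open>Q\<close> gives q with a^-1 q b^-1 nonzero. Writing q = c^-1 d,
  the factor (c a)^-1 d is nonzero, which gives \<open>R_star\<close>, and so is d b^-1, which gives
  \<open>lambda_rel\<close>.\<close>

lemma connected_S:
  assumes a: "a \<in> carrier S" "a \<noteq> zS" and b: "b \<in> carrier S" "b \<noteq> zS"
  shows "\<exists>c\<in>carrier S. \<exists>d\<in>carrier S. (c \<otimes>\<^bsub>S\<^esub> a, d) \<in> R_star S \<and> (d, b) \<in> lambda_rel S zS"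
proof -
  have "i (\<phi> a) \<noteq> z" "i (\<phi> b) \<noteq> z" using assms phi_eq_zero inv_eq_zero by auto
  then obtain q where q: "q \<in> carrier Q" "i (\<phi> a) \<otimes> (q \<otimes> i (\<phi> b)) \<noteq> z"
    using connected[of "i (\<phi> a)" "i (\<phi> b)"] a b by auto
  obtain c d where cd: "c \<in> carrier S" "d \<in> carrier S" "q = i (\<phi> c) \<otimes> \<phi> d"
    using fraction[OF q(1)] by blast
  note q = q(2)[unfolded cd(3)]
  have "i (\<phi> a) \<otimes> ((i (\<phi> c) \<otimes> \<phi> d) \<otimes> i (\<phi> b)) = ((i (\<phi> a) \<otimes> i (\<phi> c)) \<otimes> \<phi> d) \<otimes> i (\<phi> b)"
    "i (\<phi> a) \<otimes> ((i (\<phi> c) \<otimes> \<phi> d) \<otimes> i (\<phi> b)) = (i (\<phi> a) \<otimes> i (\<phi> c)) \<otimes> (\<phi> d \<otimes> i (\<phi> b))"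
    using a b cd(1,2) by (simp_all add: assoc)
  then have nz: "(i (\<phi> a) \<otimes> i (\<phi> c)) \<otimes> \<phi> d \<noteq> z" "\<phi> d \<otimes> i (\<phi> b) \<noteq> z"
    using q a b cd(1,2) by (metis mult_zero zero_mult closed inv_in phi_in)+
  have "i (\<phi> a) \<otimes> i (\<phi> c) \<noteq> z" using nz(1) cd(2) by (metis zero_mult phi_in)
  then have "i (i (\<phi> a) \<otimes> i (\<phi> c)) = \<phi> c \<otimes> \<phi> a"
    using inv_mult[of "i (\<phi> a)" "i (\<phi> c)"] a cd(1) by (simp add: inv_inv)
  then have "i (\<phi> (c \<otimes>\<^bsub>S\<^esub> a)) = i (\<phi> a) \<otimes> i (\<phi> c)"
    using inv_inv[of "i (\<phi> a) \<otimes> i (\<phi> c)"] a cd(1) by (simp add: phi_mult)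
  then have "(c \<otimes>\<^bsub>S\<^esub> a, d) \<in> R_star S"
    using nz(1) R_starI_fraction[of "c \<otimes>\<^bsub>S\<^esub> a" d] a cd by simp
  moreover have "(d, b) \<in> lambda_rel S zS" using nz(2) b cd by (simp add: lambda_iff)
  ultimately show ?thesis using cd by blast
qed

end

section \<open>Abstract left I-orders and their isomorphic copies\<close>

lemma left_I_order_imp:
  assumes "is_semigroup S" "brandt Q z (sinv Q)" "left_I_order S Q"
  shows "\<exists>\<phi>. left_order_in_brandt Q z (sinv Q) S \<phi>"
proof -
  obtain \<phi> where "\<phi> \<in> mon S Q" "left_I_order_within (\<phi> ` carrier S) Q"
    using assms unfolding left_I_order_def by blast
  then have "left_order_in_brandt_axioms Q (sinv Q) S \<phi>"
    using assms(1) unfolding left_I_order_within_def mon_def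
    by (intro left_order_in_brandt_axioms.intro) auto
  then show ?thesis by (intro exI[of _ \<phi>] left_order_in_brandt.intro assms(2))
qed

lemma (in left_order_in_brandt) left_I_order: "left_I_order S Q"
proof -
  have "\<phi> \<in> mon S Q" unfolding mon_def using hom inj by blast
  moreover have "inverse_semigroup Q" using brandt_semigroup unfolding brandt_semigroup_def by blast
  moreover have "subsemigroup (\<phi> ` carrier S) Q"
    unfolding subsemigroup_def by (auto simp flip: phi_mult)
  moreover have "\<exists>a\<in>carrier S. \<exists>b\<in>carrier S. q = sinv Q (\<phi> a) \<otimes> \<phi> b" if "q \<in> carrier Q" for q
    using fraction[OF that] sinv_eq phi_in by metis
  ultimately show ?thesis unfolding left_I_order_def left_I_order_within_def by blast
qed

text \<open>
  Sending \<open>q\<close> to the set of pairs \<open>(a, b)\<close> with \<open>q = a\<^sup>-\<^sup>1 b\<close> is injective, and so carries the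
  structure of \<open>Q\<close> over to a set of relations on \<open>S\<close>.
\<close>

lemma (in left_order_in_brandt) transport:
  "\<exists>Q' :: ('s \<times> 's) set monoid. brandt_semigroup Q' \<and> left_I_order S Q' \<and> Q \<cong> Q'"
proof -
  define f where "f q = {(a, b). a \<in> carrier S \<and> b \<in> carrier S \<and> q = i (\<phi> a) \<otimes> \<phi> b}" for q
  define g where "g = inv_into (carrier Q) f"
  define Q' :: "('s \<times> 's) set monoid" where
    "Q' = \<lparr>carrier = f ` carrier Q, mult = (\<lambda>x y. f (g x \<otimes> g y)), one = {}\<rparr>"
  \<comment> \<open>By \<open>fraction\<close> every \<open>f p\<close> is nonempty, and a single
    pair in it already determines \<open>p\<close>.\<close>
  have "inj_on f (carrier Q)"
  proof (rule inj_onI)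
    fix p q assume "p \<in> carrier Q" "f p = f q"
    then show "p = q" using fraction[of p] unfolding f_def by blast
  qed
  then have gf [simp]: "g (f q) = q" if "q \<in> carrier Q" for q
    using that unfolding g_def by simp
  have f_eq [simp]: "f p = f q \<longleftrightarrow> p = q" if "p \<in> carrier Q" "q \<in> carrier Q" for p q
    using gf that by metis
  have car [simp]: "carrier Q' = f ` carrier Q" unfolding Q'_def by simp
  have mult [simp]: "f p \<otimes>\<^bsub>Q'\<^esub> f q = f (p \<otimes> q)" if "p \<in> carrier Q" "q \<in> carrier Q" for p q
    using that unfolding Q'_def by simp
  interpret Q': brandt Q' "f z" "\<lambda>x. f (i (g x))"
  proof
    show "carrier Q' \<noteq> {f z}"
    proof
      assume "carrier Q' = {f z}"
      then have "q = z" if "q \<in> carrier Q" for q using that by (metis car f_eq imageI singletonD zero_in)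
      then show False using nontrivial by blast
    qed
    show "\<exists>c\<in>carrier Q'. x \<otimes>\<^bsub>Q'\<^esub> (c \<otimes>\<^bsub>Q'\<^esub> y) \<noteq> f z"
      if xy: "x \<in> carrier Q'" "y \<in> carrier Q'" "x \<noteq> f z" "y \<noteq> f z" for x y
    proof -
      obtain p q where pq: "x = f p" "y = f q" "p \<in> carrier Q" "q \<in> carrier Q" using xy by auto
      then obtain c where "c \<in> carrier Q" "p \<otimes> (c \<otimes> q) \<noteq> z" using connected xy by blast
      then have "f c \<in> carrier Q'" "x \<otimes>\<^bsub>Q'\<^esub> (f c \<otimes>\<^bsub>Q'\<^esub> y) \<noteq> f z" using pq by auto
      then show ?thesis by blast
    qed
  qed (unfold car, ((elim imageE)?, simp add: assoc inv_outer inv_inner inv_cancel cancel_inv)+)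
  interpret Q': left_order_in_brandt Q' "f z" "\<lambda>x. f (i (g x))" S "\<lambda>a. f (\<phi> a)"
  proof
    show "(\<lambda>a. f (\<phi> a)) \<in> hom S Q'" unfolding hom_def by (auto simp: phi_mult)
    show "inj_on (\<lambda>a. f (\<phi> a)) (carrier S)" by (rule inj_onI) (simp add: phi_eq_iff)
    show "\<exists>a\<in>carrier S. \<exists>b\<in>carrier S. x = f (i (g (f (\<phi> a)))) \<otimes>\<^bsub>Q'\<^esub> f (\<phi> b)"
      if x: "x \<in> carrier Q'" for x
    proof -
      obtain q where q: "x = f q" "q \<in> carrier Q" using x by auto
      obtain a b where ab: "a \<in> carrier S" "b \<in> carrier S" "q = i (\<phi> a) \<otimes> \<phi> b"
        using fraction[OF q(2)] by blast
      then have "x = f (i (g (f (\<phi> a)))) \<otimes>\<^bsub>Q'\<^esub> f (\<phi> b)" using q by simp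
      then show ?thesis using ab by blast
    qed
  qed (rule semigroup)
  have "f \<in> iso Q Q'"
    unfolding iso_def hom_def bij_betw_def using \<open>inj_on f (carrier Q)\<close> by auto
  then show ?thesis
    using Q'.brandt_semigroup Q'.left_I_order unfolding is_iso_def by blast
qed

section \<open>The semigroup of fractions\<close>

text \<open>
  The multiplication is total on the underlying type, so that no carrier is needed: elements
  outside the semigroup multiply to \<open>z\<close>. An element \<open>a\<close> is a nonzero element of the semigroup iff
  \<open>x \<cdot> a \<noteq> z\<close> for some \<open>x\<close>.
\<close>

locale left_ore =
  fixes m :: "'s \<Rightarrow> 's \<Rightarrow> 's" (infixl "\<cdot>" 70) and z :: 's
  assumes assoc: "(a \<cdot> b) \<cdot> c = a \<cdot> (b \<cdot> c)"
    and zero_mult [simp]: "z \<cdot> a = z"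
    and mult_zero [simp]: "a \<cdot> z = z"
    and nontrivial: "\<exists>a b. a \<cdot> b \<noteq> z"
    and categorical: "a \<cdot> b \<noteq> z \<Longrightarrow> b \<cdot> c \<noteq> z \<Longrightarrow> (a \<cdot> b) \<cdot> c \<noteq> z"
    and left_cancel: "a \<cdot> b = a \<cdot> c \<Longrightarrow> a \<cdot> c \<noteq> z \<Longrightarrow> b = c"
    and right_cancel: "b \<cdot> a = c \<cdot> a \<Longrightarrow> c \<cdot> a \<noteq> z \<Longrightarrow> b = c"
    and left_multiple: "x \<cdot> y \<noteq> z \<Longrightarrow> \<exists>w. w \<cdot> x \<noteq> z"
    and common_multiple_trans: "x \<cdot> a = y \<cdot> b \<Longrightarrow> y \<cdot> b \<noteq> z \<Longrightarrow> x' \<cdot> b = y' \<cdot> c \<Longrightarrow> y' \<cdot> c \<noteq> z \<Longrightarrow>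
      \<exists>s t. s \<cdot> a = t \<cdot> c \<and> t \<cdot> c \<noteq> z"
    and connected: "x \<cdot> a \<noteq> z \<Longrightarrow> y \<cdot> b \<noteq> z \<Longrightarrow> \<exists>e f s t s' t' w.
      s \<cdot> e = t \<cdot> a \<and> t \<cdot> a \<noteq> z \<and> s' \<cdot> f = t' \<cdot> b \<and> t' \<cdot> b \<noteq> z \<and> w \<cdot> e \<noteq> z \<and> w \<cdot> f \<noteq> z"
begin

text \<open>The left Ore condition. Both \<open>x a\<close> and \<open>y a\<close> share a nonzero
  left multiple with \<open>a\<close>, so by transitivity they share one with each other; cancelling
  \<open>a\<close> on the right leaves \<open>s x = t y\<close>.\<close>

lemma common_multiple:
  assumes "x \<cdot> a \<noteq> z" "y \<cdot> a \<noteq> z"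
  obtains s t where "s \<cdot> x = t \<cdot> y" "(s \<cdot> x) \<cdot> a \<noteq> z"
proof -
  obtain w where "w \<cdot> x \<noteq> z" using left_multiple[OF assms(1)] by blast
  then have "w \<cdot> (x \<cdot> a) = (w \<cdot> x) \<cdot> a" "(w \<cdot> x) \<cdot> a \<noteq> z"
    using categorical assms assoc by auto
  moreover obtain v where "v \<cdot> y \<noteq> z" using left_multiple[OF assms(2)] by blast
  then have "(v \<cdot> y) \<cdot> a = v \<cdot> (y \<cdot> a)" "v \<cdot> (y \<cdot> a) \<noteq> z"
    using categorical[of v y a] assms assoc by auto
  ultimately obtain s t where "s \<cdot> (x \<cdot> a) = t \<cdot> (y \<cdot> a)" "t \<cdot> (y \<cdot> a) \<noteq> z"
    using common_multiple_trans by metis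
  then have "(s \<cdot> x) \<cdot> a = (t \<cdot> y) \<cdot> a" "(t \<cdot> y) \<cdot> a \<noteq> z" by (simp_all add: assoc)
  then show ?thesis using right_cancel that by metis
qed

text \<open>Elements with a common nonzero left multiplier are \<open>\<R>\<^sup>*\<close>-related.\<close>

lemma same_domain:
  assumes "x \<cdot> a \<noteq> z" "x \<cdot> b \<noteq> z" "y \<cdot> a \<noteq> z"
  shows "y \<cdot> b \<noteq> z"
proof -
  obtain s t where st: "s \<cdot> x = t \<cdot> y" "(s \<cdot> x) \<cdot> a \<noteq> z"
    using common_multiple[OF assms(1,3)] by blast
  then have "(s \<cdot> x) \<cdot> b \<noteq> z" using categorical[of s x b] assms(2) by (metis zero_mult)
  then show ?thesis using st by (metis assoc mult_zero)
qed

text \<open>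
  The fraction \<open>a\<^sup>-\<^sup>1 b\<close>, as the set of all pairs representing it; it is empty, and represents the
  zero, unless \<open>a\<close> and \<open>b\<close> are nonzero and \<open>\<R>\<^sup>*\<close>-related.
\<close>

definition frac :: "'s \<Rightarrow> 's \<Rightarrow> ('s \<times> 's) set" where
  "frac a b = {(u, v). \<exists>s x. s \<cdot> u = x \<cdot> a \<and> s \<cdot> v = x \<cdot> b \<and> x \<cdot> a \<noteq> z \<and> x \<cdot> b \<noteq> z}"

section \<open>Calculus of the pairs representing a fraction\<close>

lemma mem_frac: "(u, v) \<in> frac a b \<longleftrightarrow>
    (\<exists>s x. s \<cdot> u = x \<cdot> a \<and> s \<cdot> v = x \<cdot> b \<and> x \<cdot> a \<noteq> z \<and> x \<cdot> b \<noteq> z)"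
  unfolding frac_def by simp

lemma mem_fracI:
  "s \<cdot> u = x \<cdot> a \<Longrightarrow> s \<cdot> v = x \<cdot> b \<Longrightarrow> x \<cdot> a \<noteq> z \<Longrightarrow> x \<cdot> b \<noteq> z \<Longrightarrow> (u, v) \<in> frac a b"
  unfolding mem_frac by blast

lemma frac_refl: "x \<cdot> a \<noteq> z \<Longrightarrow> x \<cdot> b \<noteq> z \<Longrightarrow> (a, b) \<in> frac a b"
  unfolding mem_frac by blast

lemma frac_sym:
  assumes "(u, v) \<in> frac a b"
  shows "(a, b) \<in> frac u v"
proof -
  obtain s x where s: "s \<cdot> u = x \<cdot> a" "s \<cdot> v = x \<cdot> b" "x \<cdot> a \<noteq> z" "x \<cdot> b \<noteq> z"
    using assms unfolding mem_frac by blast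
  show ?thesis by (rule mem_fracI[of x _ s]) (simp_all add: s)
qed

lemma converse_frac: "(frac a b)\<inverse> = frac b a"
  unfolding frac_def converse_unfold by auto

lemma frac_nonzero: "(u, v) \<in> frac a b \<Longrightarrow> \<exists>s. s \<cdot> u \<noteq> z \<and> s \<cdot> v \<noteq> z"
  unfolding mem_frac by metis

lemma frac_refl': "(u, v) \<in> frac a b \<Longrightarrow> (u, v) \<in> frac u v"
  using frac_nonzero frac_refl by blast

lemma frac_nonzero_iff: "(u, v) \<in> frac a b \<Longrightarrow> k \<cdot> u \<noteq> z \<longleftrightarrow> k \<cdot> v \<noteq> z"
  by (drule frac_nonzero) (use same_domain in blast)

text \<open>The Ore condition brings the old multiplier \<open>s\<close> and the new factor
  \<open>k\<close> to a common multiple \<open>p s = q k\<close>; then \<open>q\<close> and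
  \<open>p x\<close> witness membership.\<close>

lemma frac_mult: "(u, v) \<in> frac a b \<Longrightarrow> k \<cdot> u \<noteq> z \<Longrightarrow> (k \<cdot> u, k \<cdot> v) \<in> frac a b"
proof -
  assume uv: "(u, v) \<in> frac a b" and k: "k \<cdot> u \<noteq> z"
  obtain s x where s: "s \<cdot> u = x \<cdot> a" "s \<cdot> v = x \<cdot> b" "x \<cdot> a \<noteq> z" "x \<cdot> b \<noteq> z"
    using uv unfolding mem_frac by blast
  obtain p q where pq: "p \<cdot> s = q \<cdot> k" "(p \<cdot> s) \<cdot> u \<noteq> z"
    using common_multiple[of s u k] s k by metis
  have "q \<cdot> (k \<cdot> u) = (p \<cdot> x) \<cdot> a" "q \<cdot> (k \<cdot> v) = (p \<cdot> x) \<cdot> b"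
    using pq(1) s by (metis assoc)+
  moreover have "(p \<cdot> s) \<cdot> v \<noteq> z" using pq(2) uv frac_nonzero_iff by blast
  then have "(p \<cdot> x) \<cdot> a \<noteq> z" "(p \<cdot> x) \<cdot> b \<noteq> z" using pq(2) s by (metis assoc)+
  ultimately show "(k \<cdot> u, k \<cdot> v) \<in> frac a b" by (rule mem_fracI)
qed

lemma frac_mult_left: "(k \<cdot> u, k \<cdot> v) \<in> frac a b \<Longrightarrow> (u, v) \<in> frac a b"
  unfolding mem_frac assoc[symmetric] by blast

text \<open>The two witnesses meet over \<open>q\<close>: with \<open>k s = l t\<close>, cancelling
  \<open>v\<close> gives \<open>k x = l y\<close>, one multiplier serving \<open>u\<close> and
  \<open>w\<close> simultaneously.\<close>

lemma frac_comp:
  assumes "(p, q) \<in> frac u v" "(q, r) \<in> frac v w"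
  shows "(p, r) \<in> frac u w"
proof -
  obtain s x where s: "s \<cdot> p = x \<cdot> u" "s \<cdot> q = x \<cdot> v" "x \<cdot> u \<noteq> z" "x \<cdot> v \<noteq> z"
    using assms(1) unfolding mem_frac by blast
  obtain t y where t: "t \<cdot> q = y \<cdot> v" "t \<cdot> r = y \<cdot> w" "y \<cdot> v \<noteq> z" "y \<cdot> w \<noteq> z"
    using assms(2) unfolding mem_frac by blast
  obtain k l where kl: "k \<cdot> s = l \<cdot> t" "(k \<cdot> s) \<cdot> q \<noteq> z"
    using common_multiple[of s q t] s t by metis
  have "(k \<cdot> x) \<cdot> v = (l \<cdot> y) \<cdot> v" using kl(1) s t by (metis assoc)
  moreover have nz: "(k \<cdot> x) \<cdot> v \<noteq> z" using kl(2) s by (metis assoc)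
  ultimately have "k \<cdot> x = l \<cdot> y" using right_cancel by metis
  then have "(k \<cdot> s) \<cdot> p = (k \<cdot> x) \<cdot> u" "(k \<cdot> s) \<cdot> r = (k \<cdot> x) \<cdot> w"
    using kl(1) s t by (metis assoc)+
  moreover have "(k \<cdot> x) \<cdot> u \<noteq> z" using same_domain s nz by blast
  moreover have "(k \<cdot> x) \<cdot> w \<noteq> z" using same_domain t nz by blast
  ultimately show ?thesis by (rule mem_fracI)
qed

lemma frac_trans:
  assumes "(u, v) \<in> frac a b" "(p, q) \<in> frac u v"
  shows "(p, q) \<in> frac a b"
proof -
  obtain s x where s: "s \<cdot> p = x \<cdot> u" "s \<cdot> q = x \<cdot> v" "x \<cdot> u \<noteq> z"
    using assms(2) unfolding mem_frac by blast
  have "(s \<cdot> p, s \<cdot> q) \<in> frac a b" unfolding s by (rule frac_mult[OF assms(1) s(3)])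
  then show ?thesis by (rule frac_mult_left)
qed

text \<open>Any member of a fraction may serve as its representative, which is what replaces
  well-definedness arguments.\<close>

lemma frac_eq: "(u, v) \<in> frac a b \<Longrightarrow> frac u v = frac a b"
  by (intro equalityI subrelI) (use frac_trans frac_sym in blast)+

text \<open>
  Relational composition, followed by closure under cancellation of common left factors. For
  fractions the composite alone would be too small: a representative \<open>(u, v)\<close> of \<open>a\<^sup>-\<^sup>1 b\<close> with
  prescribed \<open>u\<close> may not exist until \<open>u\<close> has been multiplied on the left.
\<close>

definition closed_comp :: "('s \<times> 's) set \<Rightarrow> ('s \<times> 's) set \<Rightarrow> ('s \<times> 's) set" (infixl "\<odot>" 70) where
  "F \<odot> G = {(u, w). \<exists>s v. (s \<cdot> u, v) \<in> F \<and> (v, s \<cdot> w) \<in> G}"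

section \<open>Products of fractions\<close>

lemma mem_comp: "(u, w) \<in> F \<odot> G \<longleftrightarrow> (\<exists>s v. (s \<cdot> u, v) \<in> F \<and> (v, s \<cdot> w) \<in> G)"
  unfolding closed_comp_def by simp

lemma converse_comp: "(F \<odot> G)\<inverse> = G\<inverse> \<odot> F\<inverse>"
  by (auto simp: mem_comp; metis)

lemma empty_comp [simp]: "{} \<odot> G = {}" "F \<odot> {} = {}"
  unfolding closed_comp_def by auto

lemma frac_comp_frac:
  assumes "x \<cdot> u \<noteq> z" "x \<cdot> v \<noteq> z" "x \<cdot> w \<noteq> z"
  shows "frac u v \<odot> frac v w = frac u w"
proof (intro equalityI subrelI)
  fix p r assume "(p, r) \<in> frac u v \<odot> frac v w"
  then show "(p, r) \<in> frac u w" unfolding mem_comp using frac_comp frac_mult_left by blast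
  next
  fix p r assume "(p, r) \<in> frac u w"
  then obtain s y where s: "s \<cdot> p = y \<cdot> u" "s \<cdot> r = y \<cdot> w" "y \<cdot> u \<noteq> z" "y \<cdot> w \<noteq> z"
    unfolding mem_frac by blast
  \<comment> \<open>The element \<open>y v\<close> becomes the middle point of the composite, with
    \<open>s\<close> as the cancelled left factor.\<close>
  have "y \<cdot> v \<noteq> z" using same_domain assms s by blast
  then have "(s \<cdot> p, y \<cdot> v) \<in> frac u v" "(y \<cdot> v, s \<cdot> r) \<in> frac v w"
    using s assms frac_refl frac_mult by metis+
  then show "(p, r) \<in> frac u v \<odot> frac v w" unfolding mem_comp by blast
qed

text \<open>The analogue of a common denominator: a nonzero product has representatives in which the
  numerator of the first fraction equals the denominator of the second.\<close>

lemma comp_cases: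
  assumes "frac a b \<odot> frac c d \<noteq> {}"
  obtains u v w x where "frac a b = frac u v" "frac c d = frac v w"
    "x \<cdot> u \<noteq> z" "x \<cdot> v \<noteq> z" "x \<cdot> w \<noteq> z" "frac a b \<odot> frac c d = frac u w"
proof -
  obtain u v w where uvw: "(u, v) \<in> frac a b" "(v, w) \<in> frac c d"
    using assms unfolding closed_comp_def by blast
  obtain x where x: "x \<cdot> u \<noteq> z" "x \<cdot> v \<noteq> z" using frac_nonzero uvw by blast
  then have "x \<cdot> w \<noteq> z" using frac_nonzero_iff uvw by blast
  then show ?thesis using that x uvw frac_eq frac_comp_frac by metis
qed

lemma frac_zero: "frac z b = {}"
  unfolding frac_def by simp

definition fracs :: "('s \<times> 's) set set" where "fracs = {frac a b | a b. True}"

lemma frac_in [simp, intro]: "frac a b \<in> fracs"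
  unfolding fracs_def by blast

lemma empty_in [simp, intro]: "{} \<in> fracs"
  using frac_zero frac_in by metis

lemma converse_in [simp, intro]: "F \<in> fracs \<Longrightarrow> F\<inverse> \<in> fracs"
  unfolding fracs_def using converse_frac by blast

lemma comp_in [simp, intro]: "F \<in> fracs \<Longrightarrow> G \<in> fracs \<Longrightarrow> F \<odot> G \<in> fracs"
  unfolding fracs_def using comp_cases empty_in[unfolded fracs_def] by (smt (verit) mem_Collect_eq)

lemma fracsE: "F \<in> fracs \<Longrightarrow> (\<And>a b. F = frac a b \<Longrightarrow> P) \<Longrightarrow> P"
  unfolding fracs_def by blast

text \<open>\<open>S\<close> need not have an identity to serve as the left factor in the closed
  composition; multiplying both pairs by some \<open>k\<close> with \<open>k u\<close> and
  \<open>k v\<close> nonzero supplies one.\<close>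

lemma mem_compI:
  assumes "F \<in> fracs" "G \<in> fracs" "(u, v) \<in> F" "(v, w) \<in> G"
  shows "(u, w) \<in> F \<odot> G"
proof -
  obtain k where k: "k \<cdot> u \<noteq> z" "k \<cdot> v \<noteq> z"
    using assms(1,3) frac_nonzero by (elim fracsE) blast
  then have "(k \<cdot> u, k \<cdot> v) \<in> F" "(k \<cdot> v, k \<cdot> w) \<in> G"
    using assms frac_mult by (auto elim!: fracsE)
  then show ?thesis unfolding mem_comp by blast
qed

text \<open>The multiplier \<open>t\<close> of the inner composite is pushed onto the pair from
  \<open>H\<close>, so that it meets the pair from \<open>G\<close> at \<open>t v\<close>; the
  combined multiplier is \<open>t s\<close>.\<close>

lemma comp_subset_assoc:
  assumes "F \<in> fracs" "G \<in> fracs" "H \<in> fracs"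
  shows "(F \<odot> G) \<odot> H \<subseteq> F \<odot> (G \<odot> H)"
proof clarify
  fix p q assume "(p, q) \<in> (F \<odot> G) \<odot> H"
  then obtain s v where sv: "(s \<cdot> p, v) \<in> F \<odot> G" "(v, s \<cdot> q) \<in> H" unfolding mem_comp by blast
  then obtain t w where tw: "(t \<cdot> (s \<cdot> p), w) \<in> F" "(w, t \<cdot> v) \<in> G" unfolding mem_comp by blast
  have "t \<cdot> v \<noteq> z" using assms(2) tw(2) frac_nonzero by (elim fracsE) (metis mult_zero)
  then have "(t \<cdot> v, t \<cdot> (s \<cdot> q)) \<in> H" using assms(3) sv(2) frac_mult by (elim fracsE) blast
  then have "(w, t \<cdot> (s \<cdot> q)) \<in> G \<odot> H" using mem_compI assms tw(2) by blast
  then show "(p, q) \<in> F \<odot> (G \<odot> H)"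
    unfolding mem_comp using tw(1) assoc by metis
qed

text \<open>Converse reverses products, so the second inclusion is the first one read for the
  converses.\<close>

lemma comp_assoc:
  assumes "F \<in> fracs" "G \<in> fracs" "H \<in> fracs"
  shows "(F \<odot> G) \<odot> H = F \<odot> (G \<odot> H)"
proof
  have "(H\<inverse> \<odot> G\<inverse>) \<odot> F\<inverse> \<subseteq> H\<inverse> \<odot> (G\<inverse> \<odot> F\<inverse>)" using assms by (intro comp_subset_assoc) auto
  then have "(F \<odot> (G \<odot> H))\<inverse> \<subseteq> ((F \<odot> G) \<odot> H)\<inverse>" unfolding converse_comp .
  then show "F \<odot> (G \<odot> H) \<subseteq> (F \<odot> G) \<odot> H" by simp
qed (rule comp_subset_assoc[OF assms])

lemma converse_cancel:
  assumes "F \<in> fracs" "G \<in> fracs" "F \<odot> G \<noteq> {}"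
  shows "F\<inverse> \<odot> (F \<odot> G) = G"
proof -
  obtain a b c d where F: "F = frac a b" "G = frac c d" using assms(1,2) by (elim fracsE)
  then obtain u v w x where "F = frac u v" "G = frac v w" "x \<cdot> u \<noteq> z" "x \<cdot> v \<noteq> z" "x \<cdot> w \<noteq> z"
    "F \<odot> G = frac u w"
    using comp_cases[of a b c d] assms(3) by metis
  then show ?thesis using converse_frac frac_comp_frac by metis
qed

text \<open>The dual of \<open>converse_cancel\<close> under converse, rebracketed by
  associativity.\<close>

lemma cancel_converse:
  assumes "F \<in> fracs" "G \<in> fracs" "F \<odot> G \<noteq> {}"
  shows "F \<odot> (G \<odot> G\<inverse>) = F"
proof -
  have "G\<inverse> \<odot> F\<inverse> = (F \<odot> G)\<inverse>" by (simp add: converse_comp)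
  then have "G\<inverse> \<odot> F\<inverse> \<noteq> {}" using assms(3) by auto
  then have "((G\<inverse>)\<inverse> \<odot> (G\<inverse> \<odot> F\<inverse>))\<inverse> = (F\<inverse>)\<inverse>"
    using converse_cancel[of "G\<inverse>" "F\<inverse>"] assms(1,2) by auto
  then have "(F \<odot> G) \<odot> G\<inverse> = F" unfolding converse_comp by simp
  then show ?thesis using comp_assoc assms(1,2) by simp
qed

lemma comp_converse_self:
  assumes "F \<in> fracs"
  shows "F \<odot> (F\<inverse> \<odot> F) = F"
proof (cases "F = {}")
  case False
  then obtain a b where ab: "F = frac a b" "(a, b) \<in> F"
    using assms frac_refl' by (elim fracsE) (metis ex_in_conv frac_eq surj_pair frac_sym)
  then obtain x where "x \<cdot> a \<noteq> z" "x \<cdot> b \<noteq> z" using frac_nonzero by blast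
  then show ?thesis unfolding ab(1) converse_frac by (metis frac_comp_frac)
qed auto

text \<open>The connecting fraction is \<open>frac e f\<close>, where \<open>e\<close> shares a
  nonzero left multiple with the numerator \<open>b\<close> of \<open>F\<close>, and
  \<open>f\<close> with the denominator \<open>c\<close> of \<open>G\<close>.\<close>

lemma fracs_connected:
  assumes "F \<in> fracs" "G \<in> fracs" "F \<noteq> {}" "G \<noteq> {}"
  shows "\<exists>H\<in>fracs. F \<odot> (H \<odot> G) \<noteq> {}"
proof -
  obtain a b c d where ab: "F = frac a b" "(a, b) \<in> F" and cd: "G = frac c d" "(c, d) \<in> G"
    using assms frac_sym unfolding fracs_def
    by (smt (verit, del_insts) equals0I frac_refl' mem_Collect_eq surj_pair)
  obtain x y where x: "x \<cdot> a \<noteq> z" "x \<cdot> b \<noteq> z" and y: "y \<cdot> c \<noteq> z" "y \<cdot> d \<noteq> z"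
    using ab cd frac_nonzero by metis
  obtain e f s t s' t' w where h: "s \<cdot> e = t \<cdot> b" "t \<cdot> b \<noteq> z" "s' \<cdot> f = t' \<cdot> c" "t' \<cdot> c \<noteq> z"
    "w \<cdot> e \<noteq> z" "w \<cdot> f \<noteq> z"
    using connected[OF x(2) y(1)] by blast
  have ef: "(e, f) \<in> frac e f" using h frac_refl by blast
  then have se: "(s \<cdot> e, s \<cdot> f) \<in> frac e f" and se': "(s' \<cdot> e, s' \<cdot> f) \<in> frac e f"
    using h frac_mult frac_nonzero_iff by metis+
  have "t \<cdot> a \<noteq> z" using same_domain x h by blast
  then have "(t \<cdot> a, t \<cdot> b) \<in> F" using ab frac_mult by blast
  then have "(t \<cdot> a, s \<cdot> f) \<in> F \<odot> frac e f" using mem_compI[OF assms(1) frac_in] se h(1) by simp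
  then have FH: "F \<odot> frac e f \<noteq> {}" by blast
  have "(t' \<cdot> c, t' \<cdot> d) \<in> G" using cd h frac_mult by blast
  then have "(s' \<cdot> e, t' \<cdot> d) \<in> frac e f \<odot> G" using mem_compI[OF frac_in assms(2)] se' h(3) by simp
  then have HG: "frac e f \<odot> G \<noteq> {}" by blast
  \<comment> \<open>Two nonzero adjacent products combine: if the triple product were empty, so
    would be its left multiple by the converse of \<open>F\<close>, which is the nonempty
    \<open>frac e f \<odot> G\<close>.\<close>
  have "(F\<inverse> \<odot> (F \<odot> frac e f)) \<odot> G = frac e f \<odot> G"
    using converse_cancel assms FH by simp
  then have "F\<inverse> \<odot> (F \<odot> (frac e f \<odot> G)) \<noteq> {}"
    using comp_assoc assms HG by simp
  then have "F \<odot> (frac e f \<odot> G) \<noteq> {}" by auto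
  then show ?thesis by blast
qed

section \<open>Embedding by right translations\<close>

definition graph :: "'s \<Rightarrow> ('s \<times> 's) set" where "graph a = {(u, u \<cdot> a) | u. u \<cdot> a \<noteq> z}"

lemma mem_graph: "(u, v) \<in> graph a \<longleftrightarrow> v = u \<cdot> a \<and> u \<cdot> a \<noteq> z"
  unfolding graph_def by auto

text \<open>In the groupoid, a = x^-1 (x a) for any \<open>x\<close> composable with
  \<open>a\<close>; this places the image of the embedding among the fractions.\<close>

lemma graph_eq_frac:
  assumes "x \<cdot> a \<noteq> z"
  shows "graph a = frac x (x \<cdot> a)"
proof (intro equalityI subrelI)
  fix u v assume "(u, v) \<in> graph a"
  then have uv: "v = u \<cdot> a" "u \<cdot> a \<noteq> z" by (auto simp: mem_graph)
  obtain s t where st: "s \<cdot> u = t \<cdot> x" "(s \<cdot> u) \<cdot> a \<noteq> z" using common_multiple[OF uv(2) assms] by blast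
  then have "s \<cdot> v = t \<cdot> (x \<cdot> a)" "t \<cdot> (x \<cdot> a) \<noteq> z" "t \<cdot> x \<noteq> z" using uv by (metis assoc zero_mult)+
  then show "(u, v) \<in> frac x (x \<cdot> a)" unfolding mem_frac using st by blast
  next
  fix u v assume "(u, v) \<in> frac x (x \<cdot> a)"
  then obtain s y where s: "s \<cdot> u = y \<cdot> x" "s \<cdot> v = y \<cdot> (x \<cdot> a)" "y \<cdot> (x \<cdot> a) \<noteq> z"
    unfolding mem_frac by blast
  then have "s \<cdot> (u \<cdot> a) = s \<cdot> v" "s \<cdot> v \<noteq> z" by (metis assoc)+
  then show "(u, v) \<in> graph a" unfolding mem_graph using left_cancel mult_zero by metis
qed

lemma graph_in [simp, intro]: "graph a \<in> fracs"
proof (cases "\<exists>x. x \<cdot> a \<noteq> z")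
  case False
  then have "graph a = {}" unfolding graph_def by blast
  then show ?thesis by simp
qed (use graph_eq_frac frac_in in metis)

text \<open>One inclusion cancels the common left factor \<open>s\<close>; the other needs such a
  factor, taken from \<open>left_multiple\<close> applied to \<open>u\<close>.\<close>

lemma graph_comp: "graph a \<odot> graph b = graph (a \<cdot> b)"
proof (intro equalityI subrelI)
  fix u w assume "(u, w) \<in> graph a \<odot> graph b"
  then obtain s where "s \<cdot> w = s \<cdot> (u \<cdot> (a \<cdot> b))" "s \<cdot> w \<noteq> z"
    unfolding mem_comp mem_graph by (auto simp: assoc)
  then show "(u, w) \<in> graph (a \<cdot> b)" unfolding mem_graph using left_cancel mult_zero by metis
  next
  fix u w assume "(u, w) \<in> graph (a \<cdot> b)"
  then have uw: "w = u \<cdot> (a \<cdot> b)" "u \<cdot> (a \<cdot> b) \<noteq> z" by (auto simp: mem_graph)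
  then obtain s where "s \<cdot> u \<noteq> z" using left_multiple by blast
  then have "s \<cdot> w \<noteq> z" using categorical[of s u "a \<cdot> b"] uw by (simp add: assoc)
  then have "(s \<cdot> u, (s \<cdot> u) \<cdot> a) \<in> graph a" "((s \<cdot> u) \<cdot> a, s \<cdot> w) \<in> graph b"
    unfolding mem_graph uw(1) by (metis assoc zero_mult)+
  then show "(u, w) \<in> graph a \<odot> graph b" unfolding mem_comp by blast
qed

lemma graph_inj: "x \<cdot> a \<noteq> z \<Longrightarrow> graph a = graph b \<Longrightarrow> a = b"
  using mem_graph left_cancel by metis

text \<open>The multiplier \<open>x\<close> in the definition of \<open>frac\<close> is exactly the
  middle point of this composite.\<close>

lemma graph_converse_comp_graph: "(graph a)\<inverse> \<odot> graph b = frac a b"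
  unfolding closed_comp_def frac_def by (auto simp: mem_graph)

definition Q :: "('s \<times> 's) set monoid" where
  "Q = \<lparr>carrier = fracs, mult = (\<odot>), one = {}\<rparr>"

lemma Q_simps [simp]: "carrier Q = fracs" "x \<otimes>\<^bsub>Q\<^esub> y = x \<odot> y"
  unfolding Q_def by simp_all

sublocale Q: brandt Q "{}" converse
proof
  obtain a b where "a \<cdot> b \<noteq> z" using nontrivial by blast
  then have "graph b \<noteq> {}" using mem_graph by blast
  then show "carrier Q \<noteq> {{}}" using graph_in[of b] by auto
  show "\<exists>c\<in>carrier Q. x \<otimes>\<^bsub>Q\<^esub> (c \<otimes>\<^bsub>Q\<^esub> y) \<noteq> {}"
    if "x \<in> carrier Q" "y \<in> carrier Q" "x \<noteq> {}" "y \<noteq> {}" for x y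
    using fracs_connected that by simp
  show "x\<inverse> \<otimes>\<^bsub>Q\<^esub> (x \<otimes>\<^bsub>Q\<^esub> x\<inverse>) = x\<inverse>" if "x \<in> carrier Q" for x
    using comp_converse_self[of "x\<inverse>"] that by simp
qed (simp_all add: comp_assoc comp_converse_self converse_cancel cancel_converse)

end

section \<open>Sufficiency of the conditions\<close>

definition zmult :: "('s, 'c) monoid_scheme \<Rightarrow> 's \<Rightarrow> 's \<Rightarrow> 's \<Rightarrow> 's" where
  "zmult S z a b = (if a \<in> carrier S \<and> b \<in> carrier S then a \<otimes>\<^bsub>S\<^esub> b else z)"

lemma left_ore_zmult:
  fixes S (structure)
  assumes S: "zero_semigroup S z" and cat: "categorical_at_zero S z" and canc: "zero_cancellative S z"
    and lam: "trans (lambda_rel S z)"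
    and nz: "\<forall>a\<in>carrier S. a \<noteq> z \<longrightarrow> carrier S #> a \<noteq> {z}"
    and conn: "\<forall>a\<in>carrier S. \<forall>b\<in>carrier S. a \<noteq> z \<and> b \<noteq> z \<longrightarrow>
      (\<exists>c\<in>carrier S. \<exists>d\<in>carrier S. (c \<otimes> a, d) \<in> R_star S \<and> (d, b) \<in> lambda_rel S z)"
  shows "left_ore (zmult S z) z"
proof -
  interpret zero_semigroup S z by (rule S)
  let ?m = "zmult S z"
  have m: "?m a b = a \<otimes> b" if "a \<in> carrier S" "b \<in> carrier S" for a b
    using that unfolding zmult_def by simp
  \<comment> \<open>A nonzero value certifies that both factors are nonzero elements of the carrier,
    which lets conditions stated on \<open>S\<close> be applied to the total product.\<close>
  have m_nz: "a \<in> carrier S \<and> b \<in> carrier S \<and> ?m a b = a \<otimes> b \<and> a \<noteq> z \<and> b \<noteq> z" if "?m a b \<noteq> z" for a b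
    using that unfolding zmult_def by (auto split: if_splits)
  have left: "\<exists>w\<in>carrier S. w \<otimes> a \<noteq> z" if a: "a \<in> carrier S" "a \<noteq> z" for a
  proof -
    have "z \<in> carrier S #> a" unfolding r_coset_iff using a zero_mult zero_in by metis
    then obtain y where "y \<in> carrier S #> a" "y \<noteq> z" using nz a by blast
    then show ?thesis unfolding r_coset_iff by blast
  qed
  show ?thesis
  proof
    show "?m (?m a b) c = ?m a (?m b c)" for a b c
      unfolding zmult_def using assoc by auto
    show "?m z a = z" "?m a z = z" for a unfolding zmult_def by auto
    obtain a where "a \<in> carrier S" "a \<noteq> z" using nontrivial zero_in by blast
    then show "\<exists>a b. ?m a b \<noteq> z" using left m by metis
    show "?m (?m a b) c \<noteq> z" if "?m a b \<noteq> z" "?m b c \<noteq> z" for a b c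
      using cat m_nz[OF that(1)] m_nz[OF that(2)] that m closed
      unfolding categorical_at_zero_def by metis
    show "b = c" if "?m a b = ?m a c" "?m a c \<noteq> z" for a b c
      using canc m_nz[of a b] m_nz[of a c] that unfolding zero_cancellative_def by metis
    show "b = c" if "?m b a = ?m c a" "?m c a \<noteq> z" for a b c
      using canc m_nz[of b a] m_nz[of c a] that unfolding zero_cancellative_def by metis
    show "\<exists>w. ?m w x \<noteq> z" if "?m x y \<noteq> z" for x y
      using left m_nz[OF that] m by metis
    show "\<exists>s t. ?m s a = ?m t c \<and> ?m t c \<noteq> z"
      if h: "?m x a = ?m y b" "?m y b \<noteq> z" "?m x' b = ?m y' c" "?m y' c \<noteq> z" for x a y b x' y' c
    proof -
      have ab: "a \<in> carrier S" "b \<in> carrier S" "c \<in> carrier S" "a \<noteq> z"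
        using m_nz[of x a] m_nz[OF h(2)] m_nz[OF h(4)] h by auto
      have "(a, b) \<in> lambda_rel S z" "(b, c) \<in> lambda_rel S z"
        unfolding lambda_rel_iff[OF S] using ab h m_nz by metis+
      then have "(a, c) \<in> lambda_rel S z" using lam transD by metis
      then show ?thesis unfolding lambda_rel_iff[OF S] using ab m by metis
    qed
    show "\<exists>e f s t s' t' w. ?m s e = ?m t a \<and> ?m t a \<noteq> z \<and> ?m s' f = ?m t' b \<and> ?m t' b \<noteq> z \<and>
        ?m w e \<noteq> z \<and> ?m w f \<noteq> z"
      if h: "?m x a \<noteq> z" "?m y b \<noteq> z" for x a y b
    proof -
      note a = m_nz[OF h(1)] and b = m_nz[OF h(2)]
      obtain c d where cd: "c \<in> carrier S" "d \<in> carrier S" "(c \<otimes> a, d) \<in> R_star S"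
        "(d, b) \<in> lambda_rel S z" using conn a b by blast
      obtain u v where uv: "u \<in> carrier S" "v \<in> carrier S" "u \<otimes> d = v \<otimes> b" "v \<otimes> b \<noteq> z"
        using cd(4) b unfolding lambda_rel_iff[OF S] by blast
      \<comment> \<open>Comparing the multipliers \<open>u\<close> and \<open>z\<close>, the
        relation \<open>R_star\<close> makes \<open>c a\<close> and \<open>d\<close> be annihilated
        on the left by the same elements.\<close>
      have "u \<otimes> (c \<otimes> a) \<noteq> z"
        using R_starD[OF cd(3) uv(1) zero_in] uv cd a by simp
      moreover have "u \<otimes> (c \<otimes> a) = (u \<otimes> c) \<otimes> a" using uv cd a assoc by simp
      \<comment> \<open>The witnesses are \<open>e = c a\<close> and \<open>f = d\<close>, with
        \<open>s\<close>, \<open>s'\<close> and \<open>w\<close> all equal to \<open>u\<close>,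
        \<open>t = u c\<close> and \<open>t' = v\<close>.\<close>
      ultimately have "?m u (c \<otimes> a) = ?m (u \<otimes> c) a" "?m (u \<otimes> c) a \<noteq> z" "?m u d = ?m v b" "?m v b \<noteq> z"
        "?m u (c \<otimes> a) \<noteq> z" "?m u d \<noteq> z"
        using uv cd a b m by simp_all
      then show ?thesis by blast
    qed
  qed
qed

lemma left_ore_embedding:
  assumes S: "zero_semigroup S z" and ore: "left_ore (zmult S z) z"
    and nz: "\<forall>a\<in>carrier S. a \<noteq> z \<longrightarrow> carrier S #>\<^bsub>S\<^esub> a \<noteq> {z}"
  shows "\<exists>Q :: ('s \<times> 's) set monoid. brandt_semigroup Q \<and> left_I_order (S :: ('s, 'c) monoid_scheme) Q"
proof -
  interpret S: zero_semigroup S z by (rule S)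
  interpret left_ore "zmult S z" z by (rule ore)
  \<comment> \<open>Elements outside the carrier have an empty graph, as \<open>z\<close> does, so
    replacing them by \<open>z\<close> turns every fraction over the type into one over
    \<open>S\<close>.\<close>
  have zero_of: "(if a \<in> carrier S then a else z) \<in> carrier S"
    "graph a = graph (if a \<in> carrier S then a else z)" for a
    unfolding graph_def zmult_def by auto
  interpret left_order_in_brandt Q "{}" converse S graph
  proof
    show "is_semigroup S" using S unfolding zero_semigroup_iff by blast
    show "graph \<in> hom S Q" by (simp add: hom_def Pi_def graph_comp) (simp add: zmult_def)
    show "inj_on graph (carrier S)"
    proof (rule inj_onI)
      fix a b assume ab: "a \<in> carrier S" "b \<in> carrier S" "graph a = graph b"
      have ex: "\<exists>x. zmult S z x c \<noteq> z" if c: "c \<in> carrier S" "c \<noteq> z" for c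
      proof -
        have "z \<in> carrier S #>\<^bsub>S\<^esub> c" unfolding r_coset_iff using c S.zero_mult S.zero_in by metis
        then obtain y where "y \<in> carrier S #>\<^bsub>S\<^esub> c" "y \<noteq> z" using nz c by blast
        then show ?thesis unfolding r_coset_iff zmult_def using c by auto
      qed
      show "a = b" using ex[of a] ex[of b] ab graph_inj by metis
    qed
    show "\<exists>a\<in>carrier S. \<exists>b\<in>carrier S. q = (graph a)\<inverse> \<otimes>\<^bsub>Q\<^esub> graph b" if q: "q \<in> carrier Q" for q
    proof -
      obtain a b where "q = frac a b" using q unfolding Q_simps fracs_def by blast
      then have "q = (graph a)\<inverse> \<otimes>\<^bsub>Q\<^esub> graph b" by (simp add: graph_converse_comp_graph)
      then have "q = (graph (if a \<in> carrier S then a else z))\<inverse> \<otimes>\<^bsub>Q\<^esub>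
          graph (if b \<in> carrier S then b else z)"
        unfolding zero_of(2)[symmetric] .
      then show ?thesis using zero_of(1) by blast
    qed
  qed
  show ?thesis using Q.brandt_semigroup left_I_order by blast
qed

(* HOL cannot quantify existentially over types.  As Q = {a^-1 b | a, b in S} is a quotient of
   S x S as a set, the Brandt semigroups carried by subsets of ('s * 's) set suffice; the second
   conjunct says that nothing is lost, for Q over an arbitrary type. *)
theorem corollary3p11:
  fixes S :: "('s, 'c) monoid_scheme"
  assumes "is_semigroup S"
  shows
    "((\<exists>Q :: ('s \<times> 's) set monoid. brandt_semigroup Q \<and> left_I_order S Q) \<longleftrightarrow>
      (\<exists>z. is_zero S z \<and>
           categorical_at_zero S z \<and>
           zero_cancellative S z \<and>
           trans (lambda_rel S z) \<and>
           (\<forall>a\<in>carrier S. a \<noteq> z \<longrightarrow> carrier S #>\<^bsub>S\<^esub> a \<noteq> {z}) \<and>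
           (\<forall>a\<in>carrier S. \<forall>b\<in>carrier S. a \<noteq> z \<and> b \<noteq> z \<longrightarrow>
              (\<exists>c\<in>carrier S. \<exists>d\<in>carrier S.
                 (c \<otimes>\<^bsub>S\<^esub> a, d) \<in> R_star S \<and> (d, b) \<in> lambda_rel S z)))) \<and>
     (\<forall>Q :: ('q, 'd) monoid_scheme. brandt_semigroup Q \<and> left_I_order S Q \<longrightarrow>
        (\<exists>Q' :: ('s \<times> 's) set monoid. brandt_semigroup Q' \<and> left_I_order S Q' \<and> Q \<cong> Q'))"
proof (intro conjI iffI allI impI)
  assume "\<exists>Q :: ('s \<times> 's) set monoid. brandt_semigroup Q \<and> left_I_order S Q"
  then obtain Q :: "('s \<times> 's) set monoid" where Q: "brandt_semigroup Q" "left_I_order S Q" by blast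
  obtain z where br: "brandt Q z (sinv Q)" using brandt_semigroup_imp[OF Q(1)] ..
  obtain \<phi> where "left_order_in_brandt Q z (sinv Q) S \<phi>"
    using left_I_order_imp[OF assms br Q(2)] ..
  then interpret left_order_in_brandt Q z "sinv Q" S \<phi> .
  show "\<exists>z. is_zero S z \<and> categorical_at_zero S z \<and> zero_cancellative S z \<and>
      trans (lambda_rel S z) \<and>
      (\<forall>a\<in>carrier S. a \<noteq> z \<longrightarrow> carrier S #>\<^bsub>S\<^esub> a \<noteq> {z}) \<and>
      (\<forall>a\<in>carrier S. \<forall>b\<in>carrier S. a \<noteq> z \<and> b \<noteq> z \<longrightarrow>
        (\<exists>c\<in>carrier S. \<exists>d\<in>carrier S.
          (c \<otimes>\<^bsub>S\<^esub> a, d) \<in> R_star S \<and> (d, b) \<in> lambda_rel S z))"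
    by (intro exI[of _ zS] conjI is_zero_zS categorical_S zero_cancellative_S trans_lambda ballI impI
        left_multiples_nonzero connected_S) auto
next
  assume "\<exists>z. is_zero S z \<and> categorical_at_zero S z \<and> zero_cancellative S z \<and>
      trans (lambda_rel S z) \<and>
      (\<forall>a\<in>carrier S. a \<noteq> z \<longrightarrow> carrier S #>\<^bsub>S\<^esub> a \<noteq> {z}) \<and>
      (\<forall>a\<in>carrier S. \<forall>b\<in>carrier S. a \<noteq> z \<and> b \<noteq> z \<longrightarrow>
        (\<exists>c\<in>carrier S. \<exists>d\<in>carrier S.
          (c \<otimes>\<^bsub>S\<^esub> a, d) \<in> R_star S \<and> (d, b) \<in> lambda_rel S z))"
  then obtain z where z: "is_zero S z" "categorical_at_zero S z" "zero_cancellative S z"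
      "trans (lambda_rel S z)" "\<forall>a\<in>carrier S. a \<noteq> z \<longrightarrow> carrier S #>\<^bsub>S\<^esub> a \<noteq> {z}"
      "\<forall>a\<in>carrier S. \<forall>b\<in>carrier S. a \<noteq> z \<and> b \<noteq> z \<longrightarrow>
        (\<exists>c\<in>carrier S. \<exists>d\<in>carrier S.
          (c \<otimes>\<^bsub>S\<^esub> a, d) \<in> R_star S \<and> (d, b) \<in> lambda_rel S z)"
    by (elim exE conjE)
  have S: "zero_semigroup S z" unfolding zero_semigroup_iff using assms z(1) by blast
  show "\<exists>Q :: ('s \<times> 's) set monoid. brandt_semigroup Q \<and> left_I_order S Q"
    by (rule left_ore_embedding[OF S left_ore_zmult[OF S z(2-6)] z(5)])
next
  fix Q :: "('q, 'd) monoid_scheme" assume Q: "brandt_semigroup Q \<and> left_I_order S Q"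
  obtain z where br: "brandt Q z (sinv Q)" using brandt_semigroup_imp[OF conjunct1[OF Q]] ..
  obtain \<phi> where "left_order_in_brandt Q z (sinv Q) S \<phi>"
    using left_I_order_imp[OF assms br conjunct2[OF Q]] ..
  then show "\<exists>Q' :: ('s \<times> 's) set monoid. brandt_semigroup Q' \<and> left_I_order S Q' \<and> Q \<cong> Q'"
    by (rule left_order_in_brandt.transport)
qed

end
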